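(* Let $\lambda=(\lambda_1\ge\dots\ge\lambda_k>0)$ be a partition with $\ell(\lambda)=k$. Then, in $\mathsf{QSym}$, \[s_\lambda=\sum_{\sigma}(-1)^{\sigma}\,{\mathfrak S}^*_{(\lambda_{\sigma_1}+1-\sigma_1,\ \lambda_{\sigma_2}+2-\sigma_2,\ \dots,\ \lambda_{\sigma_k}+k-\sigma_k)},\] where the sum is over permutations $\sigma\in S_k$ such that $\lambda_{\sigma_i}+i-\sigma_i>0$ for all $i\in\{1,\dots,k\}$.
   Context: Work over $\mathbb{Q}$. A composition $\alpha=[\alpha_1,\dots,\alpha_m]$ of $n$ is a sequence of positive integers summing to $n$. $\mathsf{NSym}$ is the free associative $\mathbb{Q}$-algebra on $H_1,H_2,\dots$ ($\deg H_i=i$), degree-$n$ part $\mathsf{NSym}_n$; $H_{(a_1,\dots,a_m)}=H_{a_1}\cdots H_{a_m}$, $H_0=1$, $H_{-r}=0$. $\mathsf{QSym}\subset\mathbb{Q}[[x_1,x_2,\dots]]$ is the algebra of quasi-symmetric functions with monomial basis $M_\alpha=\sum_{i_1<\dots<i_m}x_{i_1}^{\alpha_1}\cdots x_{i_m}^{\alpha_m}$; it contains the symmetric functions $\mathsf{Sym}$, and $s_\lambda$ denotes the usual Schur function. $\mathsf{QSym}$ is paired with $\mathsf{NSym}$ by $\langle H_\alpha,M_\beta\rangle=\delta_{\alpha,\beta}$; $F^\perp$ is defined by $\langle F^\perp H,G\rangle=\langle H,FG\rangle$. With $D(\alpha)=\{\alpha_1,\dots,\alpha_1+\dots+\alpha_{m-1}\}$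 and $\alpha\le\beta$ iff $D(\beta)\subseteq D(\alpha)$, $F_\alpha=\sum_{\beta\le\alpha}M_\beta$ and $F_{1^i}=F_{(1,\dots,1)}$ ($i$ ones, $F_{1^0}=1$). $\mathbb{B}_m=\sum_{i\ge0}(-1)^iH_{m+i}F_{1^i}^\perp$; ${\mathfrak S}_\alpha=\mathbb{B}_{\alpha_1}\cdots\mathbb{B}_{\alpha_m}(1)$; these form a basis of $\mathsf{NSym}_n$ over compositions of $n$, and ${\mathfrak S}^*_\beta\in\mathsf{QSym}_n$ (compositions $\beta$ of $n$) is the dual basis, $\langle{\mathfrak S}_\alpha,{\mathfrak S}^*_\beta\rangle=\delta_{\alpha,\beta}$. *)

theory Defs
  imports Complex_Main "HOL-Library.Poly_Mapping" "HOL-Combinatorics.Permutations"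
begin

section \<open>Compositions\<close>

typedef composition = "{a :: nat list. \<forall>x \<in> set a. 0 < x}"
  morphisms parts Comp
  by (rule exI[of _ "[]"]) simp

text \<open>Under concatenation (written additively) the compositions form the free monoid on the
  positive integers.\<close>

instantiation composition :: monoid_add
begin

definition zero_composition :: composition where
  "0 = Comp []"

definition plus_composition :: "composition \<Rightarrow> composition \<Rightarrow> composition" where
  "\<alpha> + \<beta> = Comp (parts \<alpha> @ parts \<beta>)"

lemma parts_zero [simp]: "parts 0 = []"
  by (simp add: zero_composition_def Comp_inverse)

lemma parts_plus [simp]: "parts (\<alpha> + \<beta>) = parts \<alpha> @ parts \<beta>"
  unfolding plus_composition_def using parts[of \<alpha>] parts[of \<beta>]
  by (subst Comp_inverse) auto

instance
  by standard (simp_all add: parts_inject[symmetric])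

end

definition csize :: "composition \<Rightarrow> nat" where
  "csize \<alpha> = sum_list (parts \<alpha>)"

definition descent_set :: "composition \<Rightarrow> nat set" where
  "descent_set \<alpha> = {sum_list (take j (parts \<alpha>)) | j. 0 < j \<and> j < length (parts \<alpha>)}"

definition finer :: "composition \<Rightarrow> composition \<Rightarrow> bool" where
  "finer \<alpha> \<beta> \<longleftrightarrow> csize \<alpha> = csize \<beta> \<and> descent_set \<beta> \<subseteq> descent_set \<alpha>"

lemma finite_csize_eq: "finite {\<alpha>. csize \<alpha> = n}"
proof -
  have "length a \<le> sum_list a" if "\<forall>x\<in>set a. 0 < x" for a :: "nat list"
    using that by (induction a) auto
  then have "length (parts \<alpha>) \<le> csize \<alpha>" for \<alpha>
    using parts[of \<alpha>] by (simp add: csize_def)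
  moreover have "x \<le> csize \<alpha>" if "x \<in> set (parts \<alpha>)" for x \<alpha>
    using that by (simp add: csize_def member_le_sum_list)
  ultimately have "parts ` {\<alpha>. csize \<alpha> = n} \<subseteq> {a. set a \<subseteq> {..n} \<and> length a \<le> n}"
    by auto
  then have "finite (parts ` {\<alpha>. csize \<alpha> = n})"
    by (rule finite_subset) (simp add: finite_lists_length_le)
  then show ?thesis
    by (rule finite_imageD) (simp add: inj_on_def parts_inject)
qed

section \<open>Noncommutative symmetric functions\<close>

text \<open>The free associative algebra on the \<open>H\<^sub>i\<close> is the monoid algebra of the free monoid of
  compositions; the basis element of \<open>\<alpha>\<close> is \<open>H\<^sub>\<alpha>\<close> and the product is the convolution of
  \<^typ>\<open>'a \<Rightarrow>\<^sub>0 'b\<close>.\<close>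

type_synonym nsym = "composition \<Rightarrow>\<^sub>0 rat"

definition H_basis :: "composition \<Rightarrow> nsym" where
  "H_basis \<alpha> = Poly_Mapping.single \<alpha> 1"

definition nsym_H :: "int \<Rightarrow> nsym" where
  "nsym_H m = (if m < 0 then 0 else if m = 0 then 1 else H_basis (Comp [nat m]))"

section \<open>Power series in countably many variables\<close>

text \<open>The variables are indexed by \<^typ>\<open>nat\<close>, so the variable with index \<open>i\<close> is \<open>x\<^bsub>i+1\<^esub>\<close>.
  A monomial is given by its exponents.\<close>

type_synonym monomial = "nat \<Rightarrow>\<^sub>0 nat"

typedef power_series = "UNIV :: (monomial \<Rightarrow> rat) set"
  morphisms coeff Series
  by simp

lemma coeff_Series [simp]: "coeff (Series f) = f"
  by (simp add: Series_inverse)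

lemma power_series_eq_iff: "F = G \<longleftrightarrow> (\<forall>m. coeff F m = coeff G m)"
  by (simp add: coeff_inject[symmetric] fun_eq_iff)

lemma finite_monomial_le: "finite {a :: monomial. \<exists>b. a + b = m}"
proof -
  let ?l = "Poly_Mapping.lookup :: monomial \<Rightarrow> nat \<Rightarrow> nat"
  let ?N = "\<Sum>i\<in>Poly_Mapping.keys m. ?l m i"
  have bound: "?l m i \<le> ?N" if "i \<in> Poly_Mapping.keys m" for i
    using that by (simp add: member_le_sum)
  have le: "?l a i \<le> ?l m i" if "a + b = m" for a b i
    unfolding that[symmetric] by (simp add: lookup_add)
  have "?l a i \<le> ?N" if "i \<in> Poly_Mapping.keys m" "a + b = m" for a b i
    using le[OF that(2)] bound[OF that(1)] by (rule order_trans)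
  moreover have "?l a i = 0" if "i \<notin> Poly_Mapping.keys m" "a + b = m" for a b i
    using le[OF that(2), of i] that(1) by (simp add: in_keys_iff)
  ultimately have "?l ` {a. \<exists>b. a + b = m} \<subseteq>
      {f. \<forall>i. (i \<in> Poly_Mapping.keys m \<longrightarrow> f i \<in> {..?N}) \<and> (i \<notin> Poly_Mapping.keys m \<longrightarrow> f i = 0)}"
    by (auto simp del: not_in_keys_iff_lookup_eq_zero)
  then have "finite (Poly_Mapping.lookup ` {a. \<exists>b. a + b = m})"
    by (rule finite_subset) (rule finite_set_of_finite_funs, simp_all)
  then show ?thesis
    by (rule finite_imageD) (simp add: inj_on_def lookup_inject)
qed

lemma finite_splits: "finite {(a, b :: monomial). a + b = m}"
proof (rule finite_subset)
  show "{(a, b). a + b = m} \<subseteq> {a. \<exists>b. a + b = m} \<times> {a. \<exists>b. a + b = m}"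
    by clarsimp (metis add.commute)
qed (simp add: finite_monomial_le)

instantiation power_series :: comm_ring_1
begin

definition zero_power_series :: power_series where
  "0 = Series (\<lambda>m. 0)"

definition one_power_series :: power_series where
  "1 = Series (\<lambda>m. if m = 0 then 1 else 0)"

definition plus_power_series :: "power_series \<Rightarrow> power_series \<Rightarrow> power_series" where
  "F + G = Series (\<lambda>m. coeff F m + coeff G m)"

definition uminus_power_series :: "power_series \<Rightarrow> power_series" where
  "- F = Series (\<lambda>m. - coeff F m)"

definition minus_power_series :: "power_series \<Rightarrow> power_series \<Rightarrow> power_series" where
  "F - G = Series (\<lambda>m. coeff F m - coeff G m)"

definition times_power_series :: "power_series \<Rightarrow> power_series \<Rightarrow> power_series" where
  "F * G = Series (\<lambda>m. \<Sum>(a, b) \<in> {(a, b). a + b = m}. coeff F a * coeff G b)"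

lemma coeff_zero [simp]: "coeff 0 m = 0"
  by (simp add: zero_power_series_def)

lemma coeff_one: "coeff 1 m = (if m = 0 then 1 else 0)"
  by (simp add: one_power_series_def)

lemma coeff_add [simp]: "coeff (F + G) m = coeff F m + coeff G m"
  by (simp add: plus_power_series_def)

lemma coeff_uminus [simp]: "coeff (- F) m = - coeff F m"
  by (simp add: uminus_power_series_def)

lemma coeff_diff [simp]: "coeff (F - G) m = coeff F m - coeff G m"
  by (simp add: minus_power_series_def)

lemma coeff_mult: "coeff (F * G) m = (\<Sum>(a, b) \<in> {(a, b). a + b = m}. coeff F a * coeff G b)"
  by (simp add: times_power_series_def)

instance
proof
  fix F G K :: power_series
  show "F + G + K = F + (G + K)" "F + G = G + F" "0 + F = F" "- F + F = 0" "F - G = F + - G"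
    by (simp_all add: power_series_eq_iff)
  show "(0::power_series) \<noteq> 1"
    by (auto simp: power_series_eq_iff coeff_one)
  show "F * G = G * F"
    unfolding power_series_eq_iff coeff_mult
    by (intro allI sum.reindex_bij_witness[of _ prod.swap prod.swap])
      (auto simp: add.commute mult.commute)
  show "(F + G) * K = F * K + G * K"
    by (simp add: power_series_eq_iff coeff_mult split_def distrib_right sum.distrib)
  show "1 * F = F"
  proof -
    have "coeff (1 * F) m = coeff F m" for m
    proof -
      have "coeff (1 * F) m = (\<Sum>(a, b) \<in> {(0, m)}. coeff 1 a * coeff F b)"
        unfolding coeff_mult
        by (rule sum.mono_neutral_right) (auto simp: finite_splits coeff_one split: if_splits)
      then show ?thesis
        by (simp add: coeff_one)
    qed
    then show ?thesis
      by (simp add: power_series_eq_iff)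
  qed
  show "F * G * K = F * (G * K)"
  proof -
    have "coeff (F * G * K) m = coeff (F * (G * K)) m" for m
    proof -
      let ?S = "\<lambda>n. {(a, b :: monomial). a + b = n}"
      have "coeff (F * G * K) m =
          (\<Sum>p\<in>?S m. \<Sum>q\<in>?S (fst p). coeff F (fst q) * coeff G (snd q) * coeff K (snd p))"
        by (simp add: coeff_mult split_def sum_distrib_right)
      also have "\<dots> = (\<Sum>(p, q)\<in>Sigma (?S m) (\<lambda>p. ?S (fst p)).
          coeff F (fst q) * coeff G (snd q) * coeff K (snd p))"
        by (rule sum.Sigma) (simp_all add: finite_splits)
      also have "\<dots> = (\<Sum>(p, q)\<in>Sigma (?S m) (\<lambda>p. ?S (snd p)).
          coeff F (fst p) * (coeff G (fst q) * coeff K (snd q)))"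
        by (rule sum.reindex_bij_witness
            [of _ "\<lambda>(p, q). ((fst p + fst q, snd q), (fst p, fst q))"
                  "\<lambda>(p, q). ((fst q, snd q + snd p), (snd q, snd p))"])
          (auto simp: add.assoc)
      also have "\<dots> = (\<Sum>p\<in>?S m. \<Sum>q\<in>?S (snd p).
          coeff F (fst p) * (coeff G (fst q) * coeff K (snd q)))"
        by (rule sum.Sigma[symmetric]) (simp_all add: finite_splits)
      also have "\<dots> = coeff (F * (G * K)) m"
        by (simp add: coeff_mult split_def sum_distrib_left)
      finally show ?thesis .
    qed
    then show ?thesis
      by (simp add: power_series_eq_iff)
  qed
qed

end

section \<open>Quasi-symmetric functions\<close>

definition mdeg :: "monomial \<Rightarrow> nat" where
  "mdeg m = (\<Sum>i\<in>Poly_Mapping.keys m. Poly_Mapping.lookup m i)"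

text \<open>The nonzero exponents of a monomial, in the order of the variables: this is \<open>\<alpha>\<close> for
  \<open>x_(i_1)^\<alpha>_1 \<cdots> x_(i_r)^\<alpha>_r\<close> with \<open>i_1 < \<cdots> < i_r\<close>.\<close>

definition exps :: "monomial \<Rightarrow> composition" where
  "exps m = Comp (map (Poly_Mapping.lookup m) (sorted_list_of_set (Poly_Mapping.keys m)))"

definition quasi_symmetric :: "power_series \<Rightarrow> bool" where
  "quasi_symmetric F \<longleftrightarrow> (\<forall>m m'. exps m = exps m' \<longrightarrow> coeff F m = coeff F m')"

definition QSym :: "power_series set" where
  "QSym = {F. quasi_symmetric F \<and> (\<exists>d. \<forall>m. coeff F m \<noteq> 0 \<longrightarrow> mdeg m \<le> d)}"

definition QSym_hom :: "nat \<Rightarrow> power_series set" where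
  "QSym_hom n = {F. quasi_symmetric F \<and> (\<forall>m. coeff F m \<noteq> 0 \<longrightarrow> mdeg m = n)}"

text \<open>Each monomial occurs at most once in the sum that defines \<open>M\<^sub>\<alpha>\<close>.\<close>

definition qsym_M :: "composition \<Rightarrow> power_series" where
  "qsym_M \<alpha> = Series (\<lambda>m. if exps m = \<alpha> then 1 else 0)"

definition fundamental :: "composition \<Rightarrow> power_series" where
  "fundamental \<alpha> = (\<Sum>\<beta> | finer \<beta> \<alpha>. qsym_M \<beta>)"

definition ones :: "nat \<Rightarrow> composition" where
  "ones i = Comp (replicate i 1)"

section \<open>The pairing\<close>

text \<open>The coefficient of \<open>M\<^sub>\<alpha>\<close> in a quasi-symmetric \<open>F\<close> is that of \<open>x_1^\<alpha>_1 \<cdots> x_r^\<alpha>_r\<close>.\<close>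

definition M_coeff :: "power_series \<Rightarrow> composition \<Rightarrow> rat" where
  "M_coeff F \<alpha> = coeff F (Poly_Mapping.nth (parts \<alpha>))"

definition pairing :: "nsym \<Rightarrow> power_series \<Rightarrow> rat" where
  "pairing h F = (\<Sum>\<alpha>\<in>Poly_Mapping.keys h. Poly_Mapping.lookup h \<alpha> * M_coeff F \<alpha>)"

lemma exps_nth: "exps (Poly_Mapping.nth (parts \<alpha>)) = \<alpha>"
proof -
  let ?m = "Poly_Mapping.nth (parts \<alpha>)"
  have pos: "parts \<alpha> ! i \<noteq> 0" if "i < length (parts \<alpha>)" for i
    using parts[of \<alpha>] nth_mem[OF that] by fastforce
  have "Poly_Mapping.keys ?m = {i. nth_default 0 (parts \<alpha>) i \<noteq> 0}"
    unfolding lookup_nth[symmetric] by (rule set_eqI) (simp only: in_keys_iff mem_Collect_eq)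
  also have "\<dots> = set [0..<length (parts \<alpha>)]"
    using pos by (auto simp: nth_default_def)
  finally have "sorted_list_of_set (Poly_Mapping.keys ?m) = [0..<length (parts \<alpha>)]"
    by (simp del: keys_nth)
  then have "map (Poly_Mapping.lookup ?m) (sorted_list_of_set (Poly_Mapping.keys ?m)) = parts \<alpha>"
    by (intro nth_equalityI) (simp_all add: nth_default_def del: keys_nth)
  then show ?thesis
    by (simp add: exps_def parts_inverse del: keys_nth)
qed

lemma pairing_H_M: "pairing (H_basis \<alpha>) (qsym_M \<beta>) = (if \<alpha> = \<beta> then 1 else 0)"
  by (simp add: pairing_def H_basis_def M_coeff_def qsym_M_def exps_nth)

definition perp :: "power_series \<Rightarrow> nsym \<Rightarrow> nsym" where
  "perp F h = (THE h'. \<forall>G\<in>QSym. pairing h' G = pairing h (F * G))"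

section \<open>Immaculate functions and their duals\<close>

text \<open>Only finitely many terms are nonzero, since the \<open>i\<close>-th one vanishes on elements of degree less
  than \<open>i\<close>.\<close>

definition bernstein :: "int \<Rightarrow> nsym \<Rightarrow> nsym" where
  "bernstein m h =
    Sum_any (\<lambda>i :: nat. (-1) ^ i * nsym_H (m + int i) * perp (fundamental (ones i)) h)"

definition immaculate :: "composition \<Rightarrow> nsym" where
  "immaculate \<alpha> = foldr (\<lambda>a. bernstein (int a)) (parts \<alpha>) 1"

definition dual_immaculate :: "composition \<Rightarrow> power_series" where
  "dual_immaculate \<beta> = (THE F. F \<in> QSym_hom (csize \<beta>) \<and>
    (\<forall>\<alpha>. csize \<alpha> = csize \<beta> \<longrightarrow> pairing (immaculate \<alpha>) F = (if \<alpha> = \<beta> then 1 else 0)))"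

section \<open>Schur functions\<close>

definition diagram :: "nat list \<Rightarrow> (nat \<times> nat) set" where
  "diagram lam = {(i, j). i < length lam \<and> j < lam ! i}"

text \<open>Semistandard Young tableaux in matrix coordinates (row, column); a tableau is 0 outside its
  diagram, so that distinct functions are distinct tableaux. Entries are indices of variables and
  hence start at 0.\<close>

definition ssyt :: "nat list \<Rightarrow> (nat \<times> nat \<Rightarrow> nat) set" where
  "ssyt lam = {T.
    (\<forall>c. c \<notin> diagram lam \<longrightarrow> T c = 0) \<and>
    (\<forall>i j j'. j < j' \<and> (i, j) \<in> diagram lam \<and> (i, j') \<in> diagram lam \<longrightarrow> T (i, j) \<le> T (i, j')) \<and>
    (\<forall>i i' j. i < i' \<and> (i, j) \<in> diagram lam \<and> (i', j) \<in> diagram lam \<longrightarrow> T (i, j) < T (i', j))}"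

definition schur :: "nat list \<Rightarrow> power_series" where
  "schur lam = Series (\<lambda>m. of_nat (card {T \<in> ssyt lam.
    \<forall>k. card {c \<in> diagram lam. T c = k} = Poly_Mapping.lookup m k}))"

end

(* The dual immaculate functions determine coordinates on QSym: a homogeneous F equals the sum of
   the <S_alpha, F> S*_alpha, so it suffices to compute <S_alpha, s_lambda>. The adjoint of B_m sends G
   to the sum of (-1)^i e_i D_{m+i} G, where D_r extracts the coefficient of x_1^r. The generating
   function of the D_r is a ring homomorphism, so it can be applied entrywise to the Jacobi-Trudi
   determinant of s_lambda; column operations confine its effect to the first column. Since
   sum (-1)^i e_i h_{n-i} vanishes for n > 0, the adjoint deletes the row whose first entry is h_m.
   Iterating this is the Laplace expansion of the 0/1 determinant
   det [alpha_i = lambda_j - j + i], whose Leibniz expansion is the claimed signed sum.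

   The same homomorphism, with row operations instead, proves the Jacobi-Trudi formula: it splits off
   horizontal strips exactly as removing the largest entries of a tableau does. *)
theory Submission
  imports "Jordan_Normal_Form.Determinant" "HOL-Computational_Algebra.Formal_Power_Series" Defs
begin

section \<open>Monomials and the coefficients of the first variable\<close>

text \<open>Two inductions run on determinants, and each needs a suitable class of indices. For the
  pairing, row indices \<open>a i\<close> are integers subject only to \<open>a i + i\<close> being
  positive, a condition on the diagonal that survives deleting a row and forces the constant term to
  vanish when the composition is exhausted before the rows are. For Jacobi-Trudi, the shapes are
  weakly decreasing lists in which zeros are allowed, so that the size of the matrix never changes.
  There the largest entry of a tableau belongs to the last variable but D_r to the first; invariance
  of the determinant under relabelling of variables bridges the two. \<open>perp\<close> and
  \<open>dual_immaculate\<close> are definite descriptions, so the adjoint and the dual basis have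
  to be shown to exist and to be unique. The adjoint rests on degree bounds. The dual basis rests on
  lexicographic unitriangularity of the immaculate functions over the H basis: for m > 0, every
  composition occurring in B_m h begins with a part at least m.\<close>

lemma coeff_sum: "coeff (sum f A) m = (\<Sum>i\<in>A. coeff (f i) m)"
  by (induction A rule: infinite_finite_induct) auto

lemma coeff_minus_one_power: "coeff ((-1) ^ i * F) m = (-1) ^ i * coeff F m"
  by (cases "even i") auto

lemma mdeg_superset:
  assumes "finite A" "Poly_Mapping.keys m \<subseteq> A"
  shows "mdeg m = sum (Poly_Mapping.lookup m) A"
  unfolding mdeg_def by (rule sum.mono_neutral_left) (use assms in \<open>auto simp: in_keys_iff\<close>)

lemma mdeg_add: "mdeg (a + b) = mdeg a + mdeg b"
proof -
  let ?A = "Poly_Mapping.keys a \<union> Poly_Mapping.keys b"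
  have "Poly_Mapping.keys (a + b) \<subseteq> ?A"
    by (rule keys_add)
  then show ?thesis
    by (simp add: mdeg_superset[of ?A] lookup_add sum.distrib)
qed

lemma mdeg_eq_0_iff: "mdeg m = 0 \<longleftrightarrow> m = 0"
  by (auto simp: mdeg_def in_keys_iff intro!: poly_mapping_eqI)

lemma mdeg_zero [simp]: "mdeg 0 = 0"
  by (simp add: mdeg_eq_0_iff)

lemma lookup_map_key: "inj f \<Longrightarrow> Poly_Mapping.lookup (Poly_Mapping.map_key f p) k = Poly_Mapping.lookup p (f k)"
  by (simp add: map_key.rep_eq)

lemma mdeg_map_key:
  assumes "inj f" "Poly_Mapping.keys m \<subseteq> range f"
  shows "mdeg (Poly_Mapping.map_key f m) = mdeg m"
proof -
  have img: "f ` (f -` Poly_Mapping.keys m) = Poly_Mapping.keys m"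
    using assms(2) by auto
  have "mdeg m = (\<Sum>i\<in>f ` (f -` Poly_Mapping.keys m). Poly_Mapping.lookup m i)"
    by (simp only: mdeg_def img)
  also have "\<dots> = (\<Sum>i\<in>f -` Poly_Mapping.keys m. Poly_Mapping.lookup m (f i))"
    using assms(1) by (subst sum.reindex) (auto simp: inj_on_def)
  finally show ?thesis
    by (simp add: mdeg_def keys_map_key[OF assms(1)] lookup_map_key[OF assms(1)])
qed

lemma parts_exps:
  "parts (exps m) = map (Poly_Mapping.lookup m) (sorted_list_of_set (Poly_Mapping.keys m))"
  unfolding exps_def by (subst Comp_inverse) (auto simp: in_keys_iff)

lemma csize_exps: "csize (exps m) = mdeg m"
  unfolding csize_def parts_exps mdeg_def
  by (simp add: sum_list_distinct_conv_sum_set)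

lemma mdeg_nth_parts: "mdeg (Poly_Mapping.nth (parts \<alpha>)) = csize \<alpha>"
  using csize_exps[of "Poly_Mapping.nth (parts \<alpha>)"] by (simp add: exps_nth)

lemma coeff_eq_M_coeff: "quasi_symmetric F \<Longrightarrow> coeff F m = M_coeff F (exps m)"
  unfolding quasi_symmetric_def M_coeff_def by (metis exps_nth)

section \<open>Splitting off the first variable\<close>

lift_definition mcons :: "nat \<Rightarrow> monomial \<Rightarrow> monomial" is
  "\<lambda>r m k. case k of 0 \<Rightarrow> r | Suc i \<Rightarrow> m i"
proof -
  fix r and m :: "nat \<Rightarrow> nat" assume "finite {x. m x \<noteq> 0}"
  then have "finite (insert 0 (Suc ` {x. m x \<noteq> 0}))" by simp
  moreover have "x \<in> insert 0 (Suc ` {x. m x \<noteq> 0})" if "(case x of 0 \<Rightarrow> r | Suc i \<Rightarrow> m i) \<noteq> 0" for x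
    using that by (cases x) auto
  ultimately show "finite {x. (case x of 0 \<Rightarrow> r | Suc i \<Rightarrow> m i) \<noteq> 0}"
    by (metis (mono_tags, lifting) finite_subset mem_Collect_eq subsetI)
qed

lemma lookup_mcons_0 [simp]: "Poly_Mapping.lookup (mcons r m) 0 = r"
  by transfer simp

lemma lookup_mcons_Suc [simp]: "Poly_Mapping.lookup (mcons r m) (Suc i) = Poly_Mapping.lookup m i"
  by transfer simp

lemma mcons_eq_iff:
  "mcons r a = x \<longleftrightarrow> Poly_Mapping.lookup x 0 = r \<and> (\<forall>i. Poly_Mapping.lookup x (Suc i) = Poly_Mapping.lookup a i)"
proof
  assume R: "Poly_Mapping.lookup x 0 = r \<and> (\<forall>i. Poly_Mapping.lookup x (Suc i) = Poly_Mapping.lookup a i)"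
  show "mcons r a = x"
  proof (rule poly_mapping_eqI)
    fix k show "Poly_Mapping.lookup (mcons r a) k = Poly_Mapping.lookup x k"
      using R by (cases k) auto
  qed
qed auto

lemma mcons_inject [simp]: "mcons r a = mcons s b \<longleftrightarrow> r = s \<and> a = b"
  by (auto simp: mcons_eq_iff intro!: poly_mapping_eqI)

lemma mcons_collapse [simp]:
  "mcons (Poly_Mapping.lookup x 0) (Poly_Mapping.map_key Suc x) = x"
  by (simp add: mcons_eq_iff lookup_map_key)

lemma map_key_Suc_mcons [simp]: "Poly_Mapping.map_key Suc (mcons r m) = m"
  by (metis mcons_collapse mcons_inject)

lemma mcons_cases:
  obtains r a where "x = mcons r a"
  by (metis mcons_collapse)

lemma mcons_add: "mcons r a + mcons s b = mcons (r + s) (a + b)"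
  by (rule sym) (simp add: mcons_eq_iff lookup_add)

lemma mcons_0_0 [simp]: "mcons 0 0 = 0"
  by (simp add: mcons_eq_iff)

lemma mcons_eq_0_iff [simp]: "mcons r a = 0 \<longleftrightarrow> r = 0 \<and> a = 0"
  by (metis mcons_0_0 mcons_inject)

lemma keys_mcons:
  "Poly_Mapping.keys (mcons r m) = (if r = 0 then {} else {0}) \<union> Suc ` Poly_Mapping.keys m"
proof (rule Set.set_eqI)
  fix x show "x \<in> Poly_Mapping.keys (mcons r m) \<longleftrightarrow> x \<in> (if r = 0 then {} else {0}) \<union> Suc ` Poly_Mapping.keys m"
    by (cases x) (auto simp: in_keys_iff simp del: not_in_keys_iff_lookup_eq_zero)
qed

lemma mdeg_mcons [simp]: "mdeg (mcons r m) = r + mdeg m"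
proof -
  have "mdeg (mcons r m) = sum (Poly_Mapping.lookup (mcons r m)) (insert 0 (Suc ` Poly_Mapping.keys m))"
    by (rule mdeg_superset) (auto simp: keys_mcons)
  also have "\<dots> = r + mdeg m"
    by (subst sum.insert) (auto simp: sum.reindex mdeg_def)
  finally show ?thesis .
qed

lemma nth_Cons_eq_mcons: "Poly_Mapping.nth (a # as) = mcons a (Poly_Mapping.nth as)"
  by (rule sym) (simp add: mcons_eq_iff nth_default_Cons)

text \<open>Peeling off variables terminates because supports are finite. The side condition leaves
  the decomposition 0 = \<open>mcons 0 0\<close> to the base case.\<close>

lemma monomial_mcons_induct [case_names zero mcons]:
  assumes "P 0" and "\<And>r m. mcons r m \<noteq> 0 \<Longrightarrow> P m \<Longrightarrow> P (mcons r m)"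
  shows "P m"
proof -
  have "P m" if "Poly_Mapping.keys m \<subseteq> {..<n}" for n
    using that
  proof (induction n arbitrary: m)
    case 0
    then have "m = 0" by (auto intro!: poly_mapping_eqI simp: in_keys_iff)
    then show ?case using assms(1) by simp
  next
    case (Suc n)
    obtain r a where m: "m = mcons r a" by (rule mcons_cases)
    have "Poly_Mapping.keys a \<subseteq> {..<n}"
      using Suc.prems unfolding m keys_mcons by (auto split: if_splits)
    then show ?case using Suc.IH assms unfolding m by (metis mcons_0_0)
  qed
  moreover obtain n where "Poly_Mapping.keys m \<subseteq> {..<n}"
    using finite_nat_bounded[OF finite_keys] by blast
  ultimately show ?thesis by blast
qed

lemma sorted_list_of_set_image_Suc:
  assumes "finite A"
  shows "sorted_list_of_set (Suc ` A) = map Suc (sorted_list_of_set A)"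
proof (rule sorted_distinct_set_unique)
  show "sorted (map Suc (sorted_list_of_set A))"
    by (simp add: sorted_map) 
qed (use assms in \<open>auto simp: distinct_map\<close>)

lemma parts_exps_mcons:
  "parts (exps (mcons r m)) = (if r = 0 then [] else [r]) @ parts (exps m)"
proof (cases "r = 0")
  case True
  then show ?thesis
    by (simp add: parts_exps keys_mcons sorted_list_of_set_image_Suc o_def)
next
  case False
  have "sorted_list_of_set (insert 0 (Suc ` Poly_Mapping.keys m)) = 0 # map Suc (sorted_list_of_set (Poly_Mapping.keys m))"
    using sorted_list_of_set.idem_if_sorted_distinct[of "0 # map Suc (sorted_list_of_set (Poly_Mapping.keys m))"]
    by (simp add: sorted_map distinct_map del: sorted_list_of_set_insert_remove)
  with False show ?thesis
    by (simp add: parts_exps keys_mcons sorted_list_of_set_image_Suc o_def)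
qed

definition xcoeff :: "nat \<Rightarrow> power_series \<Rightarrow> power_series" where
  "xcoeff r F = Series (\<lambda>m. coeff F (mcons r m))"

lemma coeff_xcoeff [simp]: "coeff (xcoeff r F) m = coeff F (mcons r m)"
  by (simp add: xcoeff_def)

text \<open>A factorization of \<open>mcons r m\<close> is a splitting of the exponent r together
  with a factorization of \<open>m\<close>.\<close>

lemma xcoeff_mult: "xcoeff r (F * G) = (\<Sum>s=0..r. xcoeff s F * xcoeff (r - s) G)"
proof -
  have "coeff (xcoeff r (F * G)) m = coeff (\<Sum>s=0..r. xcoeff s F * xcoeff (r - s) G) m" for m
  proof -
    let ?S = "\<lambda>n. {(a, b :: monomial). a + b = n}"
    have head: "r = Poly_Mapping.lookup a 0 + Poly_Mapping.lookup b 0"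
      and tail: "Poly_Mapping.map_key Suc a + Poly_Mapping.map_key Suc b = m"
      if "a + b = mcons r m" for a b
      using that by (metis lookup_add lookup_mcons_0) (metis that inj_Suc map_key_plus map_key_Suc_mcons)
    have head': "Poly_Mapping.lookup a 0 \<le> r" "r - Poly_Mapping.lookup a 0 = Poly_Mapping.lookup b 0"
      if "a + b = mcons r m" for a b
      using head[OF that] by simp_all
    have "coeff (\<Sum>s=0..r. xcoeff s F * xcoeff (r - s) G) m =
        (\<Sum>s=0..r. \<Sum>p\<in>?S m. coeff F (mcons s (fst p)) * coeff G (mcons (r - s) (snd p)))"
      by (simp add: coeff_sum coeff_mult split_def)
    also have "\<dots> = (\<Sum>(s, p)\<in>{0..r} \<times> ?S m. coeff F (mcons s (fst p)) * coeff G (mcons (r - s) (snd p)))"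
      by (subst sum.cartesian_product) simp
    also have "\<dots> = (\<Sum>p\<in>?S (mcons r m). coeff F (fst p) * coeff G (snd p))"
      by (rule sum.reindex_bij_witness[of _
            "\<lambda>p. (Poly_Mapping.lookup (fst p) 0, (Poly_Mapping.map_key Suc (fst p), Poly_Mapping.map_key Suc (snd p)))"
            "\<lambda>(s, p). (mcons s (fst p), mcons (r - s) (snd p))"])
        (auto simp: mcons_add tail head')
    finally show ?thesis
      by (simp add: coeff_mult split_def)
  qed
  then show ?thesis by (simp add: power_series_eq_iff)
qed

text \<open>With t for \<open>fps_X\<close>, this is F(t, x_1, x_2, ...), and its coefficients are
  the D_r F. The remaining variables are renumbered, so the coefficients lie in the original ring
  and the construction can be iterated.\<close>

definition xfps :: "power_series \<Rightarrow> power_series fps" where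
  "xfps F = Abs_fps (\<lambda>r. xcoeff r F)"

lemma xfps_nth [simp]: "fps_nth (xfps F) r = xcoeff r F"
  by (simp add: xfps_def)

lemma comm_ring_hom_xfps: "comm_ring_hom xfps"
proof
  fix F G :: power_series
  show "xfps (F + G) = xfps F + xfps G"
    by (rule fps_ext) (simp add: power_series_eq_iff)
  show "xfps (F * G) = xfps F * xfps G"
    by (rule fps_ext) (simp add: fps_mult_nth xcoeff_mult)
  show "xfps 1 = 1"
    by (rule fps_ext) (auto simp: power_series_eq_iff coeff_one)
  show "xfps 0 = 0"
    by (rule fps_ext) (simp add: power_series_eq_iff)
qed

lemma comm_ring_hom_fps_const: "comm_ring_hom (fps_const :: 'a::comm_ring_1 \<Rightarrow> 'a fps)"
  by standard simp_all

text \<open>The complete homogeneous function h_n. Integer indices let the entries of a Jacobi-Trudi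
  matrix that fall below degree 0 vanish by themselves.\<close>

definition hser :: "int \<Rightarrow> power_series" where
  "hser n = Series (\<lambda>m. if int (mdeg m) = n then 1 else 0)"

lemma coeff_hser: "coeff (hser n) m = (if int (mdeg m) = n then 1 else 0)"
  by (simp add: hser_def)

lemma hser_neg: "n < 0 \<Longrightarrow> hser n = 0"
  by (auto simp: power_series_eq_iff coeff_hser)

lemma xcoeff_hser [simp]: "xcoeff r (hser n) = hser (n - int r)"
  by (auto simp: power_series_eq_iff coeff_hser)

lemma xfps_hser_neg: "n < 0 \<Longrightarrow> xfps (hser n) = 0"
  by (rule fps_ext) (auto simp: power_series_eq_iff coeff_hser hser_neg)

text \<open>\<open>xfps (hser n)\<close> is the sum of the t^r h_(n-r), and its terms from t^d on
  form t^d times the series for n - d. Column operations take d = 1; row operations take the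
  differences between neighbouring row indices.\<close>

lemma xfps_hser_telescope:
  "xfps (hser n) - fps_X ^ d * xfps (hser (n - int d)) = (\<Sum>r<d. fps_X ^ r * fps_const (hser (n - int r)))"
proof (rule fps_ext)
  fix s
  have "fps_nth (\<Sum>r<d. fps_X ^ r * fps_const (hser (n - int r))) s = (\<Sum>r<d. if r = s then hser (n - int r) else 0)"
    unfolding fps_sum_nth by (intro sum.cong) (auto simp: fps_X_power_mult_nth)
  also have "\<dots> = (if s < d then hser (n - int s) else 0)"
    by (simp add: sum.delta)
  finally show "fps_nth (xfps (hser n) - fps_X ^ d * xfps (hser (n - int d))) s =
      fps_nth (\<Sum>r<d. fps_X ^ r * fps_const (hser (n - int r))) s"
    by (auto simp: fps_X_power_mult_nth algebra_simps of_nat_diff)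
qed

text \<open>Injections are allowed besides permutations: one that enumerates a support yields
  quasi-symmetry, and a cycle of variables moves a given variable to the front.\<close>

definition symmetric_series :: "power_series \<Rightarrow> bool" where
  "symmetric_series F \<longleftrightarrow> (\<forall>f m. inj f \<longrightarrow> Poly_Mapping.keys m \<subseteq> range f \<longrightarrow>
     coeff F (Poly_Mapping.map_key f m) = coeff F m)"

lemma symmetric_series_one: "symmetric_series 1"
proof -
  have "(Poly_Mapping.map_key f m = 0) = (m = 0)" if "inj f" "Poly_Mapping.keys m \<subseteq> range f" for f :: "nat \<Rightarrow> nat" and m :: monomial
    using mdeg_map_key[of f m] that by (metis mdeg_eq_0_iff)
  then show ?thesis by (simp add: symmetric_series_def coeff_one)
qed

lemma symmetric_series_hser: "symmetric_series (hser n)"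
  by (simp add: symmetric_series_def coeff_hser mdeg_map_key)

lemma symmetric_series_uminus: "symmetric_series F \<Longrightarrow> symmetric_series (- F)"
  by (simp add: symmetric_series_def)

lemma symmetric_series_mult:
  assumes F: "symmetric_series F" and G: "symmetric_series G"
  shows "symmetric_series (F * G)"
  unfolding symmetric_series_def
proof (intro allI impI)
  fix f :: "nat \<Rightarrow> nat" and m :: monomial
  assume f: "inj f" and m: "Poly_Mapping.keys m \<subseteq> range f"
  let ?S = "\<lambda>n. {(a, b :: monomial). a + b = n}"
  let ?p = "Poly_Mapping.map_key f :: monomial \<Rightarrow> monomial"
  \<comment> \<open>Exponents are natural numbers, so nothing cancels and both factors are supported
    where \<open>m\<close> is.\<close>
  have sub: "Poly_Mapping.keys a \<subseteq> range f" "Poly_Mapping.keys b \<subseteq> range f" if "a + b = m" for a b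
    using m that by (auto simp: in_keys_iff lookup_add image_subset_iff subset_iff)
  \<comment> \<open>\<open>e\<close> transports exponents forward along \<open>f\<close>, with 0 off
    the range; on monomials supported in the range it inverts \<open>map_key f\<close>.\<close>
  define e where "e a = Abs_poly_mapping (\<lambda>k. if k \<in> range f then Poly_Mapping.lookup a (inv_into UNIV f k) else 0)" for a :: monomial
  have fin: "finite {k. (if k \<in> range f then Poly_Mapping.lookup a (inv_into UNIV f k) else 0) \<noteq> 0}" for a :: monomial
    by (rule finite_subset[of _ "f ` Poly_Mapping.keys a"]) (auto simp: f in_keys_iff)
  have ext: "Poly_Mapping.lookup (e a) k = (if k \<in> range f then Poly_Mapping.lookup a (inv_into UNIV f k) else 0)" for a :: monomial and k
    unfolding e_def by (simp only: lookup_Abs_poly_mapping[OF fin])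
  have pe: "?p (e a) = a" for a
    by (rule poly_mapping_eqI) (simp add: lookup_map_key f ext)
  have ep: "e (?p a) = a" if "Poly_Mapping.keys a \<subseteq> range f" for a
  proof (rule poly_mapping_eqI)
    fix k show "Poly_Mapping.lookup (e (?p a)) k = Poly_Mapping.lookup a k"
      using that f by (auto simp: ext lookup_map_key f_inv_into_f in_keys_iff)
  qed
  have eadd: "e a + e b = e (a + b)" for a b
    by (rule poly_mapping_eqI) (simp add: ext lookup_add)
  have "(\<Sum>p\<in>?S m. coeff F (fst p) * coeff G (snd p)) =
        (\<Sum>p\<in>?S (?p m). coeff F (fst p) * coeff G (snd p))"
  proof (rule sum.reindex_bij_witness[of _ "\<lambda>p. (e (fst p), e (snd p))" "\<lambda>p. (?p (fst p), ?p (snd p))"])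
    fix p assume "p \<in> ?S (?p m)"
    then show "(e (fst p), e (snd p)) \<in> ?S m"
      using ep[OF m] by (auto simp: eadd)
  next
    fix p assume p: "p \<in> ?S m"
    then show "(?p (fst p), ?p (snd p)) \<in> ?S (?p m)"
      by (auto simp: map_key_plus[OF f])
    from p show "(e (fst (?p (fst p), ?p (snd p))), e (snd (?p (fst p), ?p (snd p)))) = p"
      using sub[of "fst p" "snd p"] by (simp add: ep split_def)
    from p show "coeff F (fst (?p (fst p), ?p (snd p))) * coeff G (snd (?p (fst p), ?p (snd p))) = coeff F (fst p) * coeff G (snd p)"
      using sub[of "fst p" "snd p"] F G f by (simp add: symmetric_series_def split_def)
  qed (simp_all only: pe fst_conv snd_conv prod.collapse)
  then show "coeff (F * G) (?p m) = coeff (F * G) m"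
    by (simp add: coeff_mult split_def)
qed

lemma symmetric_series_imp_quasi_symmetric:
  assumes "symmetric_series F"
  shows "quasi_symmetric F"
proof -
  have "coeff F m = coeff F (Poly_Mapping.nth (parts (exps m)))" for m
  proof -
    define l where "l = sorted_list_of_set (Poly_Mapping.keys m)"
    obtain N where N: "Poly_Mapping.keys m \<subseteq> {..<N}"
      using finite_nat_bounded[OF finite_keys] by blast
    \<comment> \<open>The support comes first, in increasing order. All further indices go past the
      bound \<open>N\<close>, which keeps \<open>f\<close> injective and meets only zero
      exponents.\<close>
    define f where "f i = (if i < length l then l ! i else N + i)" for i
    have set_l: "set l = Poly_Mapping.keys m" and "distinct l"
      by (simp_all add: l_def)
    have lt: "l ! i < N" if "i < length l" for i
      using nth_mem[OF that] N set_l by auto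
    have f: "inj f"
      using \<open>distinct l\<close> by (auto simp: inj_on_def f_def nth_eq_iff_index_eq dest: lt)
    have "x \<in> range f" if "x \<in> Poly_Mapping.keys m" for x
    proof -
      from that obtain i where "i < length l" "x = l ! i"
        unfolding set_l[symmetric] in_set_conv_nth by auto
      then have "x = f i" by (simp add: f_def)
      then show ?thesis by simp
    qed
    then have sub: "Poly_Mapping.keys m \<subseteq> range f" by blast
    have "Poly_Mapping.map_key f m = Poly_Mapping.nth (parts (exps m))"
    proof (rule poly_mapping_eqI)
      fix k
      have "Poly_Mapping.lookup m (N + k) = 0"
        using N by (metis in_keys_iff lessThan_iff not_add_less1 subsetD)
      then show "Poly_Mapping.lookup (Poly_Mapping.map_key f m) k = Poly_Mapping.lookup (Poly_Mapping.nth (parts (exps m))) k"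
        by (auto simp: lookup_map_key[OF f] parts_exps nth_default_def f_def l_def[symmetric])
    qed
    then show ?thesis
      using assms f sub unfolding symmetric_series_def by metis
  qed
  then show ?thesis
    unfolding quasi_symmetric_def by metis
qed

section \<open>Jacobi-Trudi determinants\<close>

text \<open>Every subtraction uses the original left neighbour, so all of them together are one
  right multiplication by the unitriangular \<open>U\<close>.\<close>

lemma det_column_operations:
  fixes A :: "nat \<Rightarrow> nat \<Rightarrow> 'a::comm_ring_1"
  shows "det (mat k k (\<lambda>(i, j). A i j)) =
    det (mat k k (\<lambda>(i, j). case j of 0 \<Rightarrow> A i 0 | Suc l \<Rightarrow> A i j - c j * A i l))"
proof -
  define U where "U = mat k k (\<lambda>(l, j). if l = j then 1 else if Suc l = j then - c j else 0)"
  have U: "U \<in> carrier_mat k k" and A: "mat k k (\<lambda>(i, j). A i j) \<in> carrier_mat k k"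
    by (simp_all add: U_def)
  have "det U = prod_list (diag_mat U)"
    by (rule det_upper_triangular[OF _ U]) (auto simp: U_def)
  also have "diag_mat U = map (\<lambda>i. 1) [0..<k]"
    by (auto simp: diag_mat_def U_def)
  finally have "det U = 1"
    by (simp add: map_replicate_const prod_list_replicate)
  moreover have "mat k k (\<lambda>(i, j). A i j) * U =
      mat k k (\<lambda>(i, j). case j of 0 \<Rightarrow> A i 0 | Suc l \<Rightarrow> A i j - c j * A i l)" (is "_ = ?B")
  proof (rule eq_matI)
    fix i j assume "i < dim_row ?B" "j < dim_col ?B"
    then have ij: "i < k" "j < k" by simp_all
    have "(mat k k (\<lambda>(i, j). A i j) * U) $$ (i, j) =
        (\<Sum>l\<in>{0..<k}. A i l * (if l = j then 1 else if Suc l = j then - c j else 0))"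
      using ij by (simp add: scalar_prod_def U_def)
    also have "\<dots> = (\<Sum>l\<in>{0..<k}. (if l = j then A i l else 0) + (if Suc l = j then - (c j * A i l) else 0))"
      by (intro sum.cong) auto
    also have "\<dots> = A i j + (\<Sum>l\<in>{0..<k}. if Suc l = j then - (c j * A i l) else 0)"
      using ij by (simp add: sum.distrib)
    also have "\<dots> = ?B $$ (i, j)"
      using ij by (cases j) auto
    finally show "(mat k k (\<lambda>(i, j). A i j) * U) $$ (i, j) = ?B $$ (i, j)" .
  qed (simp_all add: U_def)
  ultimately show ?thesis
    using det_mult[OF A U] by simp
qed

text \<open>Left multiplication by a unitriangular matrix; each row uses the original row below
  it.\<close>

lemma det_row_operations:
  fixes A :: "nat \<Rightarrow> nat \<Rightarrow> 'a::comm_ring_1"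
  shows "det (mat k k (\<lambda>(i, j). A i j)) =
    det (mat k k (\<lambda>(i, j). if Suc i < k then A i j - c i * A (Suc i) j else A i j))"
proof -
  define U where "U = mat k k (\<lambda>(i, l). if i = l then 1 else if Suc i = l then - c i else 0)"
  have U: "U \<in> carrier_mat k k" and A: "mat k k (\<lambda>(i, j). A i j) \<in> carrier_mat k k"
    by (simp_all add: U_def)
  have "det U = prod_list (diag_mat U)"
    by (rule det_upper_triangular[OF _ U]) (auto simp: U_def)
  also have "diag_mat U = map (\<lambda>i. 1) [0..<k]"
    by (auto simp: diag_mat_def U_def)
  finally have "det U = 1"
    by (simp add: map_replicate_const prod_list_replicate)
  moreover have "U * mat k k (\<lambda>(i, j). A i j) =
      mat k k (\<lambda>(i, j). if Suc i < k then A i j - c i * A (Suc i) j else A i j)" (is "_ = ?B")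
  proof (rule eq_matI)
    fix i j assume "i < dim_row ?B" "j < dim_col ?B"
    then have ij: "i < k" "j < k" by simp_all
    have "(U * mat k k (\<lambda>(i, j). A i j)) $$ (i, j) =
        (\<Sum>l\<in>{0..<k}. (if i = l then 1 else if Suc i = l then - c i else 0) * A l j)"
      using ij by (simp add: scalar_prod_def U_def)
    also have "\<dots> = (\<Sum>l\<in>{0..<k}. (if i = l then A l j else 0) + (if Suc i = l then - (c i * A l j) else 0))"
      by (intro sum.cong) auto
    also have "\<dots> = ?B $$ (i, j)"
      using ij by (simp add: sum.distrib)
    finally show "(U * mat k k (\<lambda>(i, j). A i j)) $$ (i, j) = ?B $$ (i, j)" .
  qed (simp_all add: U_def)
  ultimately show ?thesis
    using det_mult[OF U A] by simp
qed

lemma det_mat: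
  fixes f :: "nat \<Rightarrow> nat \<Rightarrow> 'a::comm_ring_1"
  shows "det (mat k k (\<lambda>(i, j). f i j)) = (\<Sum>p | p permutes {0..<k}. signof p * (\<Prod>i<k. f i (p i)))"
proof -
  have "mat k k (\<lambda>(i, j). f i j) $$ (i, p i) = f i (p i)" if "p permutes {0..<k}" "i < k" for p i
    using that permutes_in_image[OF that(1), of i] by simp
  then show ?thesis
    by (subst det_def'[of _ k]) (auto simp: atLeast0LessThan intro!: sum.cong prod.cong)
qed

text \<open>Multilinearity in the rows: one determinant for each choice of a summand in every row.
  \<open>PiE\<close> fixes the choice functions off \<open>{..<k}\<close>, so that each choice
  counts once.\<close>

lemma det_sum_rows:
  fixes f :: "nat \<Rightarrow> 'b \<Rightarrow> nat \<Rightarrow> 'a::comm_ring_1"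
  assumes "\<And>i. i < k \<Longrightarrow> finite (S i)"
  shows "det (mat k k (\<lambda>(i, j). \<Sum>c\<in>S i. w i c * f i c j)) =
    (\<Sum>c\<in>PiE {..<k} S. (\<Prod>i<k. w i (c i)) * det (mat k k (\<lambda>(i, j). f i (c i) j)))"
proof -
  have "det (mat k k (\<lambda>(i, j). \<Sum>c\<in>S i. w i c * f i c j)) =
      (\<Sum>p | p permutes {0..<k}. signof p * (\<Prod>i<k. \<Sum>c\<in>S i. w i c * f i c (p i)))"
    by (rule det_mat)
  also have "\<dots> = (\<Sum>p | p permutes {0..<k}. \<Sum>c\<in>PiE {..<k} S. signof p * (\<Prod>i<k. w i (c i) * f i (c i) (p i)))"
    using assms by (subst prod_sum_PiE) (auto simp: sum_distrib_left)
  also have "\<dots> = (\<Sum>c\<in>PiE {..<k} S. \<Sum>p | p permutes {0..<k}. signof p * (\<Prod>i<k. w i (c i) * f i (c i) (p i)))"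
    by (rule sum.swap)
  also have "\<dots> = (\<Sum>c\<in>PiE {..<k} S. (\<Prod>i<k. w i (c i)) * det (mat k k (\<lambda>(i, j). f i (c i) j)))"
  proof (rule sum.cong[OF refl])
    fix c
    show "(\<Sum>p | p permutes {0..<k}. signof p * (\<Prod>i<k. w i (c i) * f i (c i) (p i))) =
        (\<Prod>i<k. w i (c i)) * det (mat k k (\<lambda>(i, j). f i (c i) j))"
      by (simp add: det_mat prod.distrib sum_distrib_left mult_ac)
  qed
  finally show ?thesis .
qed

text \<open>Rows and columns are counted from 0, and \<open>a i\<close> stands for \<open>\<lambda>\<^sub>i - i\<close>.\<close>

definition jt :: "nat \<Rightarrow> (nat \<Rightarrow> int) \<Rightarrow> power_series" where
  "jt k a = det (mat k k (\<lambda>(i, j). hser (a i + int j)))"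

lemma jt_cong: "(\<And>i. i < k \<Longrightarrow> a i = b i) \<Longrightarrow> jt k a = jt k b"
  unfolding jt_def by (rule arg_cong[of _ _ det]) (auto intro!: cong_mat)

lemma xfps_jt: "xfps (jt k a) = det (mat k k (\<lambda>(i, j). xfps (hser (a i + int j))))"
proof -
  interpret comm_ring_hom xfps by (rule comm_ring_hom_xfps)
  show ?thesis unfolding jt_def hom_det[symmetric]
    by (rule arg_cong[of _ _ det]) (auto simp: map_mat_def)
qed

lemma fps_const_jt: "fps_const (jt k a) = det (mat k k (\<lambda>(i, j). fps_const (hser (a i + int j))))"
proof -
  interpret comm_ring_hom "fps_const :: power_series \<Rightarrow> power_series fps"
    by (rule comm_ring_hom_fps_const)
  show ?thesis unfolding jt_def hom_det[symmetric]
    by (rule arg_cong[of _ _ det]) (auto simp: map_mat_def)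
qed

text \<open>Deleting row \<open>l\<close> and the first column; the increment accounts for the shift of the columns.\<close>

definition skip :: "nat \<Rightarrow> (nat \<Rightarrow> int) \<Rightarrow> nat \<Rightarrow> int" where
  "skip l a i = (if i < l then a i else a (Suc i)) + 1"

text \<open>Under \<open>xfps\<close>, h_(n+1) minus t times h_n telescopes to a constant in t.
  Subtracting t times the left neighbour therefore leaves t in the first column only, and the
  cofactors along it are again \<open>jt\<close> determinants.\<close>

lemma xfps_jt_expand:
  "xfps (jt (Suc k) a) = (\<Sum>l<Suc k. (-1) ^ l * xfps (hser (a l)) * fps_const (jt k (skip l a)))"
proof -
  define B where "B = mat (Suc k) (Suc k) (\<lambda>(i, j). case j of 0 \<Rightarrow> xfps (hser (a i))
    | Suc l \<Rightarrow> fps_const (hser (a i + int j)))"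
  have B: "B \<in> carrier_mat (Suc k) (Suc k)"
    by (simp add: B_def)
  have tele: "xfps (hser (n + 1)) - fps_X * xfps (hser n) = fps_const (hser (n + 1))" for n
    using xfps_hser_telescope[of "n + 1" 1] by simp
  have "xfps (jt (Suc k) a) = det (mat (Suc k) (Suc k) (\<lambda>(i, j). case j of 0 \<Rightarrow> xfps (hser (a i + int 0))
    | Suc l \<Rightarrow> xfps (hser (a i + int j)) - fps_X * xfps (hser (a i + int l))))"
    unfolding xfps_jt by (rule det_column_operations)
  also have "\<dots> = det B"
    unfolding B_def using tele[of "a i + int l" for i l]
    by (intro arg_cong[of _ _ det] cong_mat) (auto split: nat.splits simp: algebra_simps)
  also have "\<dots> = (\<Sum>l<Suc k. B $$ (l, 0) * cofactor B l 0)"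
    by (rule laplace_expansion_column[OF B]) simp
  also have "\<dots> = (\<Sum>l<Suc k. (-1) ^ l * xfps (hser (a l)) * fps_const (jt k (skip l a)))"
  proof (rule sum.cong[OF refl])
    fix l assume "l \<in> {..<Suc k}"
    then have l: "l < Suc k" by simp
    have "mat_delete B l 0 = mat k k (\<lambda>(i, j). fps_const (hser (skip l a i + int j)))"
      using l by (intro eq_matI) (auto simp: mat_delete_def B_def skip_def algebra_simps)
    then show "B $$ (l, 0) * cofactor B l 0 = (-1) ^ l * xfps (hser (a l)) * fps_const (jt k (skip l a))"
      using l by (simp add: cofactor_def fps_const_jt B_def mult_ac)
  qed
  finally show ?thesis .
qed

text \<open>Subtract from row i the next row times t^d, where d = l_i - l_(i+1) + 1 is the
  difference of their indices. Row i keeps the terms with l_(i+1) \<le> c_i \<le> l_i, so the choice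
  functions \<open>c\<close> are the shapes left by horizontal strips and the exponent of t is the
  size of the strip.\<close>

lemma xfps_jt_rows:
  fixes l :: "nat \<Rightarrow> nat"
  assumes dec: "\<And>i. Suc i < k \<Longrightarrow> l (Suc i) \<le> l i"
  shows "xfps (jt k (\<lambda>i. int (l i) - int i)) =
    (\<Sum>c\<in>PiE {..<k} (\<lambda>i. {(if Suc i < k then l (Suc i) else 0)..l i}).
      fps_X ^ (\<Sum>i<k. l i - c i) * fps_const (jt k (\<lambda>i. int (c i) - int i)))"
proof -
  define lo where "lo i = (if Suc i < k then l (Suc i) else 0)" for i
  let ?A = "\<lambda>i j. xfps (hser (int (l i) - int i + int j))"
  have "xfps (jt k (\<lambda>i. int (l i) - int i)) =
      det (mat k k (\<lambda>(i, j). if Suc i < k then ?A i j - fps_X ^ (l i + 1 - l (Suc i)) * ?A (Suc i) j else ?A i j))"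
    unfolding xfps_jt by (rule det_row_operations)
  also have "\<dots> = det (mat k k (\<lambda>(i, j). \<Sum>c\<in>{lo i..l i}. fps_X ^ (l i - c) * fps_const (hser (int c - int i + int j))))"
  proof (intro arg_cong[of _ _ det] cong_mat refl, clarify)
    fix i j assume ij: "i < k" "j < k"
    define d where "d = l i + 1 - lo i"
    have lo_le: "lo i \<le> l i"
      using dec[of i] by (simp add: lo_def)
    have "(if Suc i < k then ?A i j - fps_X ^ (l i + 1 - l (Suc i)) * ?A (Suc i) j else ?A i j) =
        ?A i j - fps_X ^ d * xfps (hser (int (l i) - int i + int j - int d))"
    proof (cases "Suc i < k")
      case True
      then have "int (l i) - int i + int j - int d = int (l (Suc i)) - int (Suc i) + int j"
        using lo_le by (simp add: d_def lo_def of_nat_diff)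
      then show ?thesis
        unfolding \<open>int (l i) - int i + int j - int d = _\<close> using True by (simp add: d_def lo_def)
    next
      case False
      \<comment> \<open>The last row has no successor. With d = l_i + 1 the index becomes j - i - 1,
        negative since j \<le> i, so the term subtracted to fit the telescoping pattern is
        0.\<close>
      then have "int (l i) - int i + int j - int d < 0"
        using ij by (simp add: d_def lo_def)
      with False show ?thesis by (simp add: xfps_hser_neg)
    qed
    also have "\<dots> = (\<Sum>r<d. fps_X ^ r * fps_const (hser (int (l i) - int i + int j - int r)))"
      by (rule xfps_hser_telescope)
    also have "\<dots> = (\<Sum>c\<in>{lo i..l i}. fps_X ^ (l i - c) * fps_const (hser (int c - int i + int j)))"
      by (rule sum.reindex_bij_witness[of _ "\<lambda>c. l i - c" "\<lambda>r. l i - r"])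
        (use lo_le in \<open>auto simp: d_def of_nat_diff algebra_simps\<close>)
    finally show "(if Suc i < k then ?A i j - fps_X ^ (l i + 1 - l (Suc i)) * ?A (Suc i) j else ?A i j) =
        (\<Sum>c\<in>{lo i..l i}. fps_X ^ (l i - c) * fps_const (hser (int c - int i + int j)))" .
  qed
  also have "\<dots> = (\<Sum>c\<in>PiE {..<k} (\<lambda>i. {lo i..l i}). (\<Prod>i<k. fps_X ^ (l i - c i)) *
      det (mat k k (\<lambda>(i, j). fps_const (hser (int (c i) - int i + int j)))))"
    by (rule det_sum_rows) simp
  also have "\<dots> = (\<Sum>c\<in>PiE {..<k} (\<lambda>i. {lo i..l i}). fps_X ^ (\<Sum>i<k. l i - c i) *
      fps_const (jt k (\<lambda>i. int (c i) - int i)))"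
    by (simp add: power_sum fps_const_jt)
  finally show ?thesis by (simp add: lo_def[abs_def])
qed

section \<open>Symmetry and bounded degree of the determinants\<close>

lemma symmetric_series_sum: "(\<And>i. i \<in> A \<Longrightarrow> symmetric_series (f i)) \<Longrightarrow> symmetric_series (sum f A)"
  by (simp add: symmetric_series_def coeff_sum)

lemma symmetric_series_prod: "(\<And>i. i \<in> A \<Longrightarrow> symmetric_series (f i)) \<Longrightarrow> symmetric_series (prod f A)"
  by (induction A rule: infinite_finite_induct) (auto simp: symmetric_series_one symmetric_series_mult)

lemma symmetric_series_jt: "symmetric_series (jt k a)"
  unfolding jt_def
  by (auto simp: det_mat sign_def intro!: symmetric_series_sum symmetric_series_mult symmetric_series_prod
      symmetric_series_one symmetric_series_uminus symmetric_series_hser)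

definition bounded_degree :: "power_series \<Rightarrow> bool" where
  "bounded_degree F \<longleftrightarrow> (\<exists>d. \<forall>m. coeff F m \<noteq> 0 \<longrightarrow> mdeg m \<le> d)"

lemma bounded_degree_add:
  assumes "bounded_degree F" "bounded_degree G" shows "bounded_degree (F + G)"
proof -
  obtain d e where "\<And>m. coeff F m \<noteq> 0 \<Longrightarrow> mdeg m \<le> d" "\<And>m. coeff G m \<noteq> 0 \<Longrightarrow> mdeg m \<le> e"
    using assms unfolding bounded_degree_def by blast
  then have "mdeg m \<le> max d e" if "coeff (F + G) m \<noteq> 0" for m
    using that by (metis add_cancel_left_left coeff_add max.coboundedI1 max.coboundedI2)
  then show ?thesis unfolding bounded_degree_def by blast
qed

lemma bounded_degree_mult:
  assumes "bounded_degree F" "bounded_degree G" shows "bounded_degree (F * G)"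
proof -
  obtain d e where de: "\<And>m. coeff F m \<noteq> 0 \<Longrightarrow> mdeg m \<le> d" "\<And>m. coeff G m \<noteq> 0 \<Longrightarrow> mdeg m \<le> e"
    using assms unfolding bounded_degree_def by blast
  have "mdeg m \<le> d + e" if "coeff (F * G) m \<noteq> 0" for m
  proof -
    from that obtain a b where "a + b = m" "coeff F a * coeff G b \<noteq> 0"
      unfolding coeff_mult split_def
      by (auto elim!: sum.not_neutral_contains_not_neutral)
    then show ?thesis
      using de(1)[of a] de(2)[of b] mdeg_add[of a b] by (simp add: add_mono)
  qed
  then show ?thesis unfolding bounded_degree_def by blast
qed

lemma bounded_degree_zero: "bounded_degree 0"
  by (simp add: bounded_degree_def)

lemma bounded_degree_one: "bounded_degree 1"
  by (auto simp: bounded_degree_def coeff_one)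

lemma bounded_degree_uminus: "bounded_degree F \<Longrightarrow> bounded_degree (- F)"
  by (simp add: bounded_degree_def)

lemma bounded_degree_hser: "bounded_degree (hser n)"
  unfolding bounded_degree_def coeff_hser by (intro exI[of _ "nat n"]) auto

lemma bounded_degree_sum: "(\<And>i. i \<in> A \<Longrightarrow> bounded_degree (f i)) \<Longrightarrow> bounded_degree (sum f A)"
  by (induction A rule: infinite_finite_induct) (auto simp: bounded_degree_zero bounded_degree_add)

lemma bounded_degree_prod: "(\<And>i. i \<in> A \<Longrightarrow> bounded_degree (f i)) \<Longrightarrow> bounded_degree (prod f A)"
  by (induction A rule: infinite_finite_induct) (auto simp: bounded_degree_one bounded_degree_mult)

lemma bounded_degree_jt: "bounded_degree (jt k a)"
  unfolding jt_def
  by (auto simp: det_mat sign_def intro!: bounded_degree_sum bounded_degree_mult bounded_degree_prod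
      bounded_degree_one bounded_degree_uminus bounded_degree_hser)

lemma jt_in_QSym: "jt k a \<in> QSym"
  using bounded_degree_jt symmetric_series_imp_quasi_symmetric[OF symmetric_series_jt]
  by (simp add: QSym_def bounded_degree_def)

section \<open>Semistandard tableaux\<close>

lemma diagram_Sigma: "diagram lam = Sigma {..<length lam} (\<lambda>i. {..<lam ! i})"
  by (auto simp: diagram_def)

lemma finite_diagram: "finite (diagram lam)"
  by (simp add: diagram_Sigma)

lemma card_diagram: "card (diagram lam) = sum_list lam"
  by (simp add: diagram_Sigma sum_list_sum_nth atLeast0LessThan)

definition content_ssyt :: "nat list \<Rightarrow> monomial \<Rightarrow> (nat \<times> nat \<Rightarrow> nat) set" where
  "content_ssyt lam m = {T \<in> ssyt lam. \<forall>k. card {c \<in> diagram lam. T c = k} = Poly_Mapping.lookup m k}"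

lemma coeff_schur: "coeff (schur lam) m = of_nat (card (content_ssyt lam m))"
  by (simp add: schur_def content_ssyt_def)

lemma content_ssyt_entry:
  assumes "T \<in> content_ssyt lam m" "c \<in> diagram lam"
  shows "T c \<in> Poly_Mapping.keys m"
proof -
  have "c \<in> {c' \<in> diagram lam. T c' = T c}"
    using assms by simp
  moreover have "finite {c' \<in> diagram lam. T c' = T c}"
    by (simp add: finite_diagram)
  ultimately have "card {c' \<in> diagram lam. T c' = T c} \<noteq> 0"
    by (metis card_eq_0_iff empty_iff)
  then show ?thesis
    using assms(1) by (simp add: content_ssyt_def in_keys_iff)
qed

lemma finite_content_ssyt: "finite (content_ssyt lam m)"
proof (rule finite_subset)
  show "content_ssyt lam m \<subseteq>
      {T. \<forall>c. (c \<in> diagram lam \<longrightarrow> T c \<in> Poly_Mapping.keys m) \<and> (c \<notin> diagram lam \<longrightarrow> T c = 0)}"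
    using content_ssyt_entry by (auto simp: content_ssyt_def ssyt_def)
qed (rule finite_set_of_finite_funs[OF finite_diagram finite_keys])

lemma mdeg_content_ssyt:
  assumes "T \<in> content_ssyt lam m"
  shows "mdeg m = sum_list lam"
proof -
  have "mdeg m = (\<Sum>k\<in>Poly_Mapping.keys m. card {c \<in> diagram lam. T c = k})"
    using assms by (simp add: mdeg_def content_ssyt_def)
  also have "\<dots> = card (\<Union>k\<in>Poly_Mapping.keys m. {c \<in> diagram lam. T c = k})"
    by (rule card_UN_disjoint[symmetric]) (auto simp: finite_diagram)
  also have "(\<Union>k\<in>Poly_Mapping.keys m. {c \<in> diagram lam. T c = k}) = diagram lam"
    using content_ssyt_entry[OF assms] by auto
  finally show ?thesis
    by (simp add: card_diagram)
qed

text \<open>The shapes that remain when a horizontal strip is removed from \<open>lam\<close>.\<close>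

definition strips :: "nat list \<Rightarrow> nat list set" where
  "strips lam = {mu. length mu = length lam \<and>
    (\<forall>i<length lam. mu ! i \<in> {(if Suc i < length lam then lam ! Suc i else 0)..lam ! i})}"

lemma finite_strips: "finite (strips lam)"
proof (rule finite_subset)
  show "strips lam \<subseteq> {mu. set mu \<subseteq> {..Max (set lam)} \<and> length mu = length lam}"
  proof clarify
    fix mu assume mu: "mu \<in> strips lam"
    have "mu ! i \<le> Max (set lam)" if "i < length lam" for i
    proof -
      have "mu ! i \<le> lam ! i" using mu that by (simp add: strips_def)
      also have "\<dots> \<le> Max (set lam)" using that by simp
      finally show ?thesis .
    qed
    with mu show "set mu \<subseteq> {..Max (set lam)} \<and> length mu = length lam"
      by (auto simp: strips_def in_set_conv_nth)
  qed
qed (simp add: finite_lists_length_eq)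

text \<open>Interlacing: mu_j \<le> lam_j \<le> lam_(i+1) \<le> mu_i for i < j. This keeps the
  induction on shapes among weakly decreasing lists.\<close>

lemma sorted_wrt_strips:
  assumes "sorted_wrt (\<ge>) lam" "mu \<in> strips lam"
  shows "sorted_wrt (\<ge>) mu"
proof -
  have "mu ! j \<le> mu ! i" if ij: "i < j" "j < length mu" for i j
  proof -
    have "mu ! j \<le> lam ! j" and "lam ! Suc i \<le> mu ! i"
      using assms(2) ij by (auto simp: strips_def dest!: spec[of _ i])
    moreover have "lam ! j \<le> lam ! Suc i"
      using assms ij by (cases "j = Suc i") (auto simp: strips_def sorted_wrt_iff_nth_less)
    ultimately show ?thesis by linarith
  qed
  then show ?thesis by (simp add: sorted_wrt_iff_nth_less)
qed

lemma down_closed_eq_lessThan: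
  fixes S :: "nat set"
  assumes "finite S" "\<And>i j. j \<in> S \<Longrightarrow> i < j \<Longrightarrow> i \<in> S"
  shows "S = {..<card S}"
proof -
  define N where "N = (LEAST n. n \<notin> S)"
  have "\<exists>n. n \<notin> S"
    using assms(1) ex_new_if_finite infinite_UNIV_nat by blast
  then have "N \<notin> S"
    unfolding N_def by (rule LeastI_ex)
  moreover have "i \<in> S" if "i < N" for i
    using not_less_Least[of i "\<lambda>n. n \<notin> S"] that by (auto simp: N_def)
  ultimately have "S = {..<N}"
    using assms(2) by (auto simp: not_less[symmetric]) (metis linorder_neqE_nat)
  then show ?thesis by simp
qed

section \<open>Removing the largest entry of a tableau\<close>

context
  fixes lam :: "nat list" and n r :: nat and m :: monomial
  assumes dec: "sorted_wrt (\<ge>) lam" and keys: "Poly_Mapping.keys m \<subseteq> {..<n}"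
begin

text \<open>Here \<open>n\<close> is the largest possible entry, \<open>r\<close> its multiplicity
  and \<open>m\<close> the content of the smaller entries. The tableaux are fibred by the shape that
  the entries below \<open>n\<close> fill.\<close>

definition strip_ssyt :: "nat list \<Rightarrow> (nat \<times> nat \<Rightarrow> nat) set" where
  "strip_ssyt mu = {T \<in> content_ssyt lam (m + Poly_Mapping.single n r).
     \<forall>c\<in>diagram lam. T c < n \<longleftrightarrow> c \<in> diagram mu}"

lemma dec_nth: "i \<le> j \<Longrightarrow> j < length lam \<Longrightarrow> lam ! j \<le> lam ! i"
  using dec by (cases "i = j") (auto simp: sorted_wrt_iff_nth_less)

lemma lookup_m_ge: "k \<ge> n \<Longrightarrow> Poly_Mapping.lookup m k = 0"
  using keys by (metis in_keys_iff lessThan_iff not_less subsetD)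

lemma content_ssyt_le:
  assumes "T \<in> content_ssyt lam (m + Poly_Mapping.single n r)" "c \<in> diagram lam"
  shows "T c \<le> n"
proof -
  have "T c \<in> Poly_Mapping.keys (m + Poly_Mapping.single n r)"
    by (rule content_ssyt_entry[OF assms])
  then show ?thesis
    using lookup_m_ge[of "T c"] by (cases "T c \<le> n") (auto simp: in_keys_iff lookup_add lookup_single)
qed

lemma strips_diagram_subset: "mu \<in> strips lam \<Longrightarrow> diagram mu \<subseteq> diagram lam"
  by (force simp: strips_def diagram_def)

text \<open>The horizontal strip condition: lam_(i') \<le> lam_(i+1) \<le> mu_i, so a removed cell
  has no cell of \<open>lam\<close> beneath it.\<close>

lemma strips_diagram_below:
  assumes "mu \<in> strips lam" "i < i'" "(i', j) \<in> diagram lam"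
  shows "(i, j) \<in> diagram mu"
proof -
  have i: "Suc i < length lam" "i' < length lam"
    using assms by (auto simp: diagram_def)
  then have "lam ! i' \<le> lam ! Suc i" "lam ! Suc i \<le> mu ! i" "length mu = length lam"
    using assms dec_nth[of "Suc i" i'] by (auto simp: strips_def dest!: spec[of _ i])
  with assms i show ?thesis by (auto simp: diagram_def)
qed

text \<open>Weakly increasing rows make the entries below \<open>n\<close> an initial segment of
  each row. Strictly increasing columns put such an entry above every cell of the next row, which is
  the lower bound in \<open>strips\<close>.\<close>

lemma content_ssyt_decompose:
  assumes T: "T \<in> content_ssyt lam (m + Poly_Mapping.single n r)"
  shows "\<exists>mu \<in> strips lam. sum_list lam = sum_list mu + r \<and> T \<in> strip_ssyt mu"
proof -
  have le: "T c \<le> n" if "c \<in> diagram lam" for c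
    using content_ssyt_le[OF T that] .
  define S where "S i = {j. j < lam ! i \<and> T (i, j) < n}" for i
  have row: "T (i, j) \<le> T (i, j')" if "i < length lam" "j < j'" "j' < lam ! i" for i j j'
    using T that unfolding content_ssyt_def ssyt_def diagram_def by auto
  have col: "T (i, j) < T (i', j)" if "i < i'" "i' < length lam" "j < lam ! i'" for i i' j
    using T that dec_nth[of i i'] unfolding content_ssyt_def ssyt_def diagram_def by auto
  have S: "S i = {..<card (S i)}" if "i < length lam" for i
    by (rule down_closed_eq_lessThan) (use row[OF that] in \<open>auto simp: S_def intro: le_less_trans\<close>)
  define mu where "mu = map (\<lambda>i. card (S i)) [0..<length lam]"
  have mem: "(i, j) \<in> diagram mu \<longleftrightarrow> (i, j) \<in> diagram lam \<and> T (i, j) < n" for i j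
  proof (cases "i < length lam")
    case True
    have "j \<in> S i \<longleftrightarrow> j < card (S i)"
      using S[OF True] by (metis lessThan_iff)
    with True show ?thesis
      by (auto simp: diagram_def mu_def S_def)
  qed (simp add: diagram_def mu_def)
  have "card (S i) \<le> lam ! i" for i
    using card_mono[of "{..<lam ! i}" "S i"] by (auto simp: S_def)
  moreover have "lam ! Suc i \<le> card (S i)" if "Suc i < length lam" for i
  proof -
    have "j \<in> S i" if "j < lam ! Suc i" for j
      using col[of i "Suc i" j] le[of "(Suc i, j)"] dec_nth[of i "Suc i"] \<open>Suc i < length lam\<close> that
      by (auto simp: S_def diagram_def)
    then have "{..<lam ! Suc i} \<subseteq> S i" by auto
    then show ?thesis
      using card_mono[of "S i" "{..<lam ! Suc i}"] by (simp add: S_def)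
  qed
  ultimately have mu: "mu \<in> strips lam"
    by (auto simp: strips_def mu_def)
  have TA: "T \<in> strip_ssyt mu"
    using T mem by (auto simp: strip_ssyt_def)
  \<comment> \<open>Entries are at most \<open>n\<close>, so the cells outside \<open>mu\<close> all
    carry \<open>n\<close>, and counting them gives the difference of the sizes.\<close>
  have "{c \<in> diagram lam. T c = n} = diagram lam - diagram mu"
    using mem le by (force simp: order_le_less)
  moreover have "card {c \<in> diagram lam. T c = n} = r"
    using T lookup_m_ge[of n] by (simp add: content_ssyt_def lookup_add)
  ultimately have "card (diagram lam) = card (diagram mu) + r"
    using card_Diff_subset[of "diagram mu" "diagram lam"] strips_diagram_subset[OF mu] finite_diagram
      card_mono[of "diagram lam" "diagram mu"] by (metis le_add_diff_inverse)
  then show ?thesis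
    using mu TA by (auto simp: card_diagram)
qed

lemma card_strip_ssyt:
  assumes mu: "mu \<in> strips lam" and size: "sum_list lam = sum_list mu + r"
  shows "card (strip_ssyt mu) = card (content_ssyt mu m)"
proof -
  \<comment> \<open>\<open>?f\<close> erases the entries \<open>n\<close> and \<open>?g\<close>
    refills the strip with them. Outside the respective diagram both take the value 0 that
    \<open>ssyt\<close> prescribes.\<close>
  let ?f = "\<lambda>T c. if c \<in> diagram mu then T c else 0 :: nat"
  let ?g = "\<lambda>T c. if c \<in> diagram mu then T c else if c \<in> diagram lam then n else 0 :: nat"
  note sub = strips_diagram_subset[OF mu]
  have mu_below: "(i, j) \<in> diagram mu" if "i < i'" "(i', j) \<in> diagram mu" for i i' j
    using strips_diagram_below[OF mu that(1)] that sub by auto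
  have mu_left: "(i, j) \<in> diagram mu" if "j < j'" "(i, j') \<in> diagram mu" for i j j'
    using that by (auto simp: diagram_def)
  have entry: "T c < n" if "T \<in> content_ssyt mu m" "c \<in> diagram mu" for T c
    using content_ssyt_entry[OF that] keys by auto
  have "bij_betw ?f (strip_ssyt mu) (content_ssyt mu m)"
  proof (rule bij_betw_byWitness[where f' = ?g])
    show "\<forall>T\<in>strip_ssyt mu. ?g (?f T) = T"
    proof
      fix T assume T: "T \<in> strip_ssyt mu"
      show "?g (?f T) = T"
      proof
        fix c
        have "T c = 0" if "c \<notin> diagram lam"
          using T that by (simp add: strip_ssyt_def content_ssyt_def ssyt_def del: split_paired_All)
        moreover have "T c = n" if "c \<in> diagram lam" "c \<notin> diagram mu"
        proof -
          have "T c \<le> n"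
            using T that(1) by (intro content_ssyt_le) (simp_all add: strip_ssyt_def)
          moreover have "\<not> T c < n"
            using T that unfolding strip_ssyt_def by blast
          ultimately show ?thesis by simp
        qed
        ultimately show "?g (?f T) c = T c" by auto
      qed
    qed
    show "\<forall>T\<in>content_ssyt mu m. ?f (?g T) = T"
    proof
      fix T assume T: "T \<in> content_ssyt mu m"
      then have "T c = 0" if "c \<notin> diagram mu" for c
        using that by (simp add: content_ssyt_def ssyt_def del: split_paired_All)
      then show "?f (?g T) = T" by (auto simp: fun_eq_iff)
    qed
    show "?f ` strip_ssyt mu \<subseteq> content_ssyt mu m"
    proof clarify
      fix T assume T: "T \<in> strip_ssyt mu"
      have "T \<in> ssyt lam"
        using T by (simp add: strip_ssyt_def content_ssyt_def)
      then have "T (i, j) \<le> T (i, j')" if "j < j'" "(i, j) \<in> diagram mu" "(i, j') \<in> diagram mu" for i j j'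
        using that sub unfolding ssyt_def by blast
      moreover have "T (i, j) < T (i', j)" if "i < i'" "(i, j) \<in> diagram mu" "(i', j) \<in> diagram mu" for i i' j
        using \<open>T \<in> ssyt lam\<close> that sub unfolding ssyt_def by blast
      ultimately have "?f T \<in> ssyt mu"
        unfolding ssyt_def by auto
      moreover have "card {c \<in> diagram mu. ?f T c = k} = Poly_Mapping.lookup m k" for k
      proof (cases "k < n")
        case True
        then have "{c \<in> diagram mu. ?f T c = k} = {c \<in> diagram lam. T c = k}"
          using T sub by (auto simp: strip_ssyt_def simp del: split_paired_All)
        with True T show ?thesis
          by (simp add: strip_ssyt_def content_ssyt_def lookup_add lookup_single)
      next
        case False
        then have "{c \<in> diagram mu. ?f T c = k} = {}"
          using T sub by (auto simp: strip_ssyt_def)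
        with False show ?thesis
          using lookup_m_ge[of k] by (simp only: card.empty)
      qed
      ultimately show "?f T \<in> content_ssyt mu m"
        by (simp add: content_ssyt_def)
    qed
    show "?g ` content_ssyt mu m \<subseteq> strip_ssyt mu"
    proof clarify
      fix T assume T: "T \<in> content_ssyt mu m"
      have row: "T (i, j) \<le> T (i, j')" if "j < j'" "(i, j') \<in> diagram mu" for i j j'
        using T that mu_left[OF that] unfolding content_ssyt_def ssyt_def by auto
      have col: "T (i, j) < T (i', j)" if "i < i'" "(i', j) \<in> diagram mu" for i i' j
        using T that mu_below[OF that] unfolding content_ssyt_def ssyt_def by auto
      have "?g T (i, j) \<le> ?g T (i, j')" if "j < j'" "(i, j) \<in> diagram lam" "(i, j') \<in> diagram lam" for i j j'
        using that row[of j j' i] mu_left[of j j' i] entry[OF T, of "(i, j)"] by auto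
      \<comment> \<open>The upper cell always lies in \<open>mu\<close>, so its entry is below
        \<open>n\<close>; this settles the case of a strip cell underneath.\<close>
      moreover have "?g T (i, j) < ?g T (i', j)" if "i < i'" "(i, j) \<in> diagram lam" "(i', j) \<in> diagram lam" for i i' j
        using that col[of i i' j] strips_diagram_below[OF mu, of i i' j] entry[OF T, of "(i, j)"] by auto
      ultimately have "?g T \<in> ssyt lam"
        using sub unfolding ssyt_def by auto
      moreover have "card {c \<in> diagram lam. ?g T c = k} = Poly_Mapping.lookup (m + Poly_Mapping.single n r) k" for k
      proof -
        have "{c \<in> diagram lam. ?g T c = k} = {c \<in> diagram mu. T c = k} \<union> (if k = n then diagram lam - diagram mu else {})"
          using sub by auto
        moreover have "card \<dots> = card {c \<in> diagram mu. T c = k} + (if k = n then r else 0)"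
          using size card_Diff_subset[OF finite_diagram sub]
          by (subst card_Un_disjoint) (auto simp: finite_diagram card_diagram)
        ultimately show ?thesis
          using T by (simp add: content_ssyt_def lookup_add lookup_single when_def)
      qed
      ultimately show "?g T \<in> strip_ssyt mu"
        using sub entry[OF T] by (auto simp: strip_ssyt_def content_ssyt_def)
    qed
  qed
  then show ?thesis by (rule bij_betw_same_card)
qed

lemma card_content_ssyt_step:
  "card (content_ssyt lam (m + Poly_Mapping.single n r)) =
    (\<Sum>mu | mu \<in> strips lam \<and> sum_list lam = sum_list mu + r. card (content_ssyt mu m))"
proof -
  let ?I = "{mu. mu \<in> strips lam \<and> sum_list lam = sum_list mu + r}"
  have eq: "content_ssyt lam (m + Poly_Mapping.single n r) = (\<Union>mu\<in>?I. strip_ssyt mu)"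
    using content_ssyt_decompose by (auto simp: strip_ssyt_def)
  have "mu = nu" if "T \<in> strip_ssyt mu" "T \<in> strip_ssyt nu" "mu \<in> ?I" "nu \<in> ?I" for T mu nu
  proof -
    have "diagram mu = {c \<in> diagram lam. T c < n}" "diagram nu = {c \<in> diagram lam. T c < n}"
      using that strips_diagram_subset by (auto simp: strip_ssyt_def)
    then have d: "(i, j) \<in> diagram mu \<longleftrightarrow> (i, j) \<in> diagram nu" for i j by simp
    \<comment> \<open>Equal lengths make the diagram determine the shape; trailing zeros are
      invisible in a diagram.\<close>
    have len: "length mu = length lam" "length nu = length lam"
      using that by (simp_all add: strips_def)
    show ?thesis
    proof (rule nth_equalityI)
      fix i assume "i < length mu"
      then have "j < mu ! i \<longleftrightarrow> j < nu ! i" for j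
        using d[of i j] len by (simp add: diagram_def)
      then show "mu ! i = nu ! i"
        by (metis linorder_neqE_nat less_irrefl)
    qed (simp add: len)
  qed
  then have "card (\<Union>mu\<in>?I. strip_ssyt mu) = (\<Sum>mu\<in>?I. card (strip_ssyt mu))"
    by (intro card_UN_disjoint)
      (auto intro: finite_subset[OF _ finite_strips] finite_subset[OF _ finite_content_ssyt] simp: strip_ssyt_def)
  then show ?thesis
    unfolding eq by (simp add: card_strip_ssyt)
qed

end

section \<open>The Jacobi-Trudi formula\<close>

lemma coeff_jt_step:
  fixes l :: "nat \<Rightarrow> nat"
  assumes dec: "\<And>i. Suc i < k \<Longrightarrow> l (Suc i) \<le> l i" and keys: "Poly_Mapping.keys m \<subseteq> {..<n}"
  shows "coeff (jt k (\<lambda>i. int (l i) - int i)) (m + Poly_Mapping.single n r) =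
    (\<Sum>c\<in>PiE {..<k} (\<lambda>i. {(if Suc i < k then l (Suc i) else 0)..l i}).
      if (\<Sum>i<k. l i - c i) = r then coeff (jt k (\<lambda>i. int (c i) - int i)) m else 0)"
proof -
  \<comment> \<open>The variable to be removed has index \<open>n\<close>, while \<open>xfps\<close>
    splits off index 0. The cycle \<open>f\<close> moves index \<open>n\<close> to the front, and by
    symmetry of \<open>jt\<close> the coefficient does not change.\<close>
  define f where "f k = (if k = 0 then n else if k \<le> n then k - 1 else k)" for k
  have f: "inj f"
    by (auto simp: inj_on_def f_def split: if_splits)
  have surj: "range f = UNIV"
  proof -
    have "k \<in> range f" for k
      by (rule range_eqI[of _ _ "if k = n then 0 else if k < n then Suc k else k"]) (auto simp: f_def)
    then show ?thesis by auto
  qed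
  have m0: "Poly_Mapping.lookup m k = 0" if "k \<ge> n" for k
    using keys that by (metis in_keys_iff lessThan_iff not_less subsetD)
  have "mcons r m = Poly_Mapping.map_key f (m + Poly_Mapping.single n r)"
    unfolding mcons_eq_iff using m0
    by (auto simp: lookup_map_key[OF f] lookup_add lookup_single f_def when_def)
  then have "coeff (jt k (\<lambda>i. int (l i) - int i)) (m + Poly_Mapping.single n r) =
      coeff (jt k (\<lambda>i. int (l i) - int i)) (mcons r m)"
    using symmetric_series_jt f surj unfolding symmetric_series_def by (metis subset_UNIV)
  also have "\<dots> = coeff (fps_nth (xfps (jt k (\<lambda>i. int (l i) - int i))) r) m"
    by simp
  also have "\<dots> = (\<Sum>c\<in>PiE {..<k} (\<lambda>i. {(if Suc i < k then l (Suc i) else 0)..l i}).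
      if (\<Sum>i<k. l i - c i) = r then coeff (jt k (\<lambda>i. int (c i) - int i)) m else 0)"
    by (subst xfps_jt_rows, erule dec, unfold fps_sum_nth coeff_sum, intro sum.cong) (auto simp: fps_X_power_mult_nth)
  finally show ?thesis .
qed

lemma coeff_mult_0: "coeff (F * G) 0 = coeff F 0 * coeff G 0"
proof -
  have "{(a, b :: monomial). a + b = 0} = {(0, 0)}"
    by (auto simp flip: mdeg_eq_0_iff simp: mdeg_add)
  then show ?thesis by (simp add: coeff_mult)
qed

lemma coeff_prod_0: "coeff (prod f A) 0 = (\<Prod>i\<in>A. coeff (f i) 0)"
  by (induction A rule: infinite_finite_induct) (auto simp: coeff_mult_0 coeff_one)

lemma hser_0: "hser 0 = 1"
  by (auto simp: power_series_eq_iff coeff_hser coeff_one mdeg_eq_0_iff)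

text \<open>Without cells the matrix is upper unitriangular, as its entries are the h_(j-i), and
  there is just the empty tableau. Otherwise the first part is positive, so the first row has
  entries of positive degree only, and no tableau has empty content.\<close>

lemma coeff_jt_0:
  assumes dec: "sorted_wrt (\<ge>) lam"
  shows "coeff (jt (length lam) (\<lambda>i. int (lam ! i) - int i)) 0 = of_nat (card (content_ssyt lam 0))"
proof (cases "diagram lam = {}")
  case True
  let ?A = "mat (length lam) (length lam) (\<lambda>(i, j). hser (int (lam ! i) - int i + int j))"
  have lam0: "lam ! i = 0" if "i < length lam" for i
    using True that by (auto simp: diagram_def)
  have "content_ssyt lam 0 = {\<lambda>c. 0}"
    using True by (auto simp: content_ssyt_def ssyt_def)
  moreover have "det ?A = prod_list (diag_mat ?A)"
    by (rule det_upper_triangular) (auto simp: lam0 hser_neg)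
  moreover have "diag_mat ?A = map (\<lambda>i. 1) [0..<length lam]"
    by (auto simp: diag_mat_def lam0 hser_0)
  ultimately show ?thesis
    by (simp add: jt_def map_replicate_const prod_list_replicate coeff_one)
next
  case False
  then obtain i j where "i < length lam" "j < lam ! i"
    by (auto simp: diagram_def)
  then have pos: "0 < lam ! 0" "0 < length lam"
    using dec by (cases "i = 0"; force simp: sorted_wrt_iff_nth_less)+
  have "content_ssyt lam 0 = {}"
    using content_ssyt_entry[of _ lam 0] False by auto
  moreover have "coeff (\<Prod>i<length lam. hser (int (lam ! i) - int i + int (p i))) 0 = 0" for p
    unfolding coeff_prod_0 using pos by (intro prod_zero bexI[of _ 0]) (auto simp: coeff_hser)
  then have "coeff (jt (length lam) (\<lambda>i. int (lam ! i) - int i)) 0 = 0"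
    unfolding jt_def det_mat coeff_sum by (intro sum.neutral) (simp add: coeff_mult_0)
  ultimately show ?thesis by simp
qed

text \<open>Induction on a bound for the variables that occur, with the shape varying: both sides
  satisfy the same recursion over \<open>strips\<close>.\<close>

lemma jacobi_trudi:
  assumes "sorted_wrt (\<ge>) lam"
  shows "schur lam = jt (length lam) (\<lambda>i. int (lam ! i) - int i)"
proof -
  have "coeff (jt (length lam) (\<lambda>i. int (lam ! i) - int i)) m = of_nat (card (content_ssyt lam m))"
    if "Poly_Mapping.keys m \<subseteq> {..<n}" for n m
    using assms that
  proof (induction n arbitrary: m lam)
    case 0
    then have "m = 0" by (auto intro!: poly_mapping_eqI simp: in_keys_iff)
    then show ?case using coeff_jt_0[OF 0(1)] by simp
  next
    case (Suc n)
    define r where "r = Poly_Mapping.lookup m n"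
    define m' where "m' = m - Poly_Mapping.single n r"
    have m: "m = m' + Poly_Mapping.single n r"
      by (rule poly_mapping_eqI) (auto simp: m'_def lookup_add lookup_minus lookup_single r_def when_def)
    have keys: "Poly_Mapping.keys m' \<subseteq> {..<n}"
    proof
      fix x assume "x \<in> Poly_Mapping.keys m'"
      then have "Poly_Mapping.lookup m x \<noteq> 0" "x \<noteq> n"
        by (auto simp: m'_def in_keys_iff lookup_minus lookup_single r_def when_def simp del: not_in_keys_iff_lookup_eq_zero)
      then show "x \<in> {..<n}"
        using Suc.prems(2) by (metis in_keys_iff lessThan_iff less_Suc_eq subsetD)
    qed
    let ?k = "length lam"
    let ?J = "\<lambda>c :: nat \<Rightarrow> nat. coeff (jt ?k (\<lambda>i. int (c i) - int i)) m'"
    let ?P = "PiE {..<?k} (\<lambda>i. {(if Suc i < ?k then lam ! Suc i else 0)..lam ! i})"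
    have dec: "lam ! Suc i \<le> lam ! i" if "Suc i < ?k" for i
      using Suc.prems(1) that by (simp add: sorted_wrt_iff_nth_less)
    \<comment> \<open>Since c_i \<le> lam_i the natural subtraction is exact, and the exponent of t
      is the number of removed cells.\<close>
    have size: "(\<Sum>i<?k. lam ! i - c i) = r \<longleftrightarrow> sum_list lam = (\<Sum>i<?k. c i) + r" if "c \<in> ?P" for c
    proof -
      have "(\<Sum>i<?k. lam ! i) = (\<Sum>i<?k. c i + (lam ! i - c i))"
        using that by (intro sum.cong) (auto simp: PiE_iff)
      then show ?thesis
        by (auto simp: sum.distrib sum_list_sum_nth atLeast0LessThan)
    qed
    have "coeff (jt ?k (\<lambda>i. int (lam ! i) - int i)) m = (\<Sum>c\<in>?P. if (\<Sum>i<?k. lam ! i - c i) = r then ?J c else 0)"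
      unfolding m by (rule coeff_jt_step[of ?k "nth lam", OF dec keys])
    also have "\<dots> = (\<Sum>c | c \<in> ?P \<and> sum_list lam = (\<Sum>i<?k. c i) + r. ?J c)"
      using size by (simp add: sum.inter_filter finite_PiE cong: sum.cong)
    \<comment> \<open>Choice functions on the row indices and lists of the same length carry the
      same data; \<open>jt\<close> reads only indices below its size.\<close>
    also have "\<dots> = (\<Sum>mu | mu \<in> strips lam \<and> sum_list lam = sum_list mu + r. ?J (nth mu))"
    proof (rule sum.reindex_bij_witness[of _ "\<lambda>mu. restrict (nth mu) {..<?k}" "\<lambda>c. map c [0..<?k]"])
      fix c assume c: "c \<in> {c \<in> ?P. sum_list lam = (\<Sum>i<?k. c i) + r}"
      then show "restrict (nth (map c [0..<?k])) {..<?k} = c"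
        by (auto simp: restrict_def fun_eq_iff PiE_iff extensional_def)
      from c show "map c [0..<?k] \<in> {mu \<in> strips lam. sum_list lam = sum_list mu + r}"
        by (auto simp: strips_def PiE_iff sum_list_sum_nth atLeast0LessThan)
      show "?J (nth (map c [0..<?k])) = ?J c"
        by (intro arg_cong[of _ _ "\<lambda>F. coeff F m'"] jt_cong) auto
    next
      fix mu assume mu: "mu \<in> {mu \<in> strips lam. sum_list lam = sum_list mu + r}"
      then have len: "length mu = ?k" by (simp add: strips_def)
      show "map (restrict (nth mu) {..<?k}) [0..<?k] = mu"
        using len by (intro nth_equalityI) auto
      show "restrict (nth mu) {..<?k} \<in> {c \<in> ?P. sum_list lam = (\<Sum>i<?k. c i) + r}"
        using mu len by (auto simp: strips_def sum_list_sum_nth atLeast0LessThan)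
    qed
    also have "\<dots> = (\<Sum>mu | mu \<in> strips lam \<and> sum_list lam = sum_list mu + r. of_nat (card (content_ssyt mu m')))"
    proof (rule sum.cong[OF refl])
      fix mu assume mu: "mu \<in> {mu \<in> strips lam. sum_list lam = sum_list mu + r}"
      then have "length mu = ?k" by (simp add: strips_def)
      then show "?J (nth mu) = of_nat (card (content_ssyt mu m'))"
        using Suc.IH[OF sorted_wrt_strips[OF Suc.prems(1)] keys, of mu] mu by simp
    qed
    also have "\<dots> = of_nat (card (content_ssyt lam m))"
      unfolding m card_content_ssyt_step[OF Suc.prems(1) keys] by simp
    finally show ?case .
  qed
  then have "coeff (jt (length lam) (\<lambda>i. int (lam ! i) - int i)) m = coeff (schur lam) m" for m
    unfolding coeff_schur using finite_nat_bounded[OF finite_keys] by blast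
  then show ?thesis by (simp add: power_series_eq_iff)
qed

lemma schur_in_QSym_hom:
  assumes "sorted_wrt (\<ge>) lam"
  shows "schur lam \<in> QSym_hom (sum_list lam)"
proof -
  have "mdeg m = sum_list lam" if "coeff (schur lam) m \<noteq> 0" for m
  proof -
    from that have "content_ssyt lam m \<noteq> {}"
      by (auto simp: coeff_schur)
    then show ?thesis using mdeg_content_ssyt by blast
  qed
  moreover have "quasi_symmetric (schur lam)"
    unfolding jacobi_trudi[OF assms]
    by (rule symmetric_series_imp_quasi_symmetric[OF symmetric_series_jt])
  ultimately show ?thesis by (simp add: QSym_hom_def)
qed

section \<open>The pairing and the adjoint of the Bernstein operators\<close>

lemma M_coeff_sum: "M_coeff (sum f A) \<alpha> = (\<Sum>i\<in>A. M_coeff (f i) \<alpha>)"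
  by (simp add: M_coeff_def coeff_sum)

lemma M_coeff_minus_one_power: "M_coeff ((-1) ^ i * F) \<alpha> = (-1) ^ i * M_coeff F \<alpha>"
  by (simp add: M_coeff_def coeff_minus_one_power)

lemma M_coeff_qsym_M: "M_coeff (qsym_M \<beta>) \<alpha> = (if \<alpha> = \<beta> then 1 else 0)"
  by (simp add: M_coeff_def qsym_M_def exps_nth)

lemma pairing_superset:
  assumes "finite A" "Poly_Mapping.keys h \<subseteq> A"
  shows "pairing h F = (\<Sum>\<alpha>\<in>A. Poly_Mapping.lookup h \<alpha> * M_coeff F \<alpha>)"
  unfolding pairing_def by (rule sum.mono_neutral_left) (use assms in \<open>auto simp: in_keys_iff\<close>)

lemma pairing_zero_left [simp]: "pairing 0 F = 0"
  by (simp add: pairing_def)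

lemma pairing_add_left: "pairing (h + h') F = pairing h F + pairing h' F"
proof -
  let ?A = "Poly_Mapping.keys h \<union> Poly_Mapping.keys h'"
  have "Poly_Mapping.keys (h + h') \<subseteq> ?A"
    by (rule keys_add)
  then show ?thesis
    by (simp add: pairing_superset[of ?A] lookup_add sum.distrib distrib_right)
qed

lemma pairing_sum_left: "pairing (sum f A) F = (\<Sum>i\<in>A. pairing (f i) F)"
  by (induction A rule: infinite_finite_induct) (auto simp: pairing_add_left)

lemma pairing_uminus_left: "pairing (- h) F = - pairing h F"
  using pairing_add_left[of h "- h" F] by simp

lemma pairing_minus_one_power_left: "pairing ((-1) ^ i * h) F = (-1) ^ i * pairing h F"
  by (cases "even i") (auto simp: pairing_uminus_left)

lemma pairing_sum_right: "pairing h (sum f A) = (\<Sum>i\<in>A. pairing h (f i))"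
  unfolding pairing_def M_coeff_sum sum_distrib_left by (rule sum.swap)

lemma pairing_minus_one_power_right: "pairing h ((-1) ^ i * F) = (-1) ^ i * pairing h F"
  by (simp add: pairing_def M_coeff_minus_one_power sum_distrib_left mult.left_commute)

lemma pairing_zero_right [simp]: "pairing h 0 = 0"
  by (simp add: pairing_def M_coeff_def)

lemma pairing_single: "pairing (Poly_Mapping.single \<alpha> c) F = c * M_coeff F \<alpha>"
  by (subst pairing_superset[of "{\<alpha>}"]) auto

lemma pairing_qsym_M: "pairing h (qsym_M \<beta>) = Poly_Mapping.lookup h \<beta>"
  by (subst pairing_superset[of "insert \<beta> (Poly_Mapping.keys h)"])
    (auto simp: M_coeff_qsym_M if_distrib cong: if_cong)

lemma pairing_eq_0:
  assumes "\<forall>\<alpha>\<in>Poly_Mapping.keys h. csize \<alpha> \<le> d" "\<And>m. coeff F m \<noteq> 0 \<Longrightarrow> d < mdeg m"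
  shows "pairing h F = 0"
proof -
  have "M_coeff F \<alpha> = 0" if "\<alpha> \<in> Poly_Mapping.keys h" for \<alpha>
    using assms(1) that assms(2)[of "Poly_Mapping.nth (parts \<alpha>)"]
    by (force simp: M_coeff_def mdeg_nth_parts)
  then show ?thesis by (simp add: pairing_def)
qed

lemma poly_mapping_eq_sum_single:
  "h = (\<Sum>k\<in>Poly_Mapping.keys h. Poly_Mapping.single k (Poly_Mapping.lookup h k))"
proof (rule poly_mapping_eqI)
  fix x
  have "(\<Sum>k\<in>Poly_Mapping.keys h. Poly_Mapping.lookup (Poly_Mapping.single k (Poly_Mapping.lookup h k)) x)
      = (\<Sum>k\<in>Poly_Mapping.keys h. if k = x then Poly_Mapping.lookup h k else 0)"
    by (intro sum.cong) (auto simp: lookup_single when_def)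
  also have "\<dots> = Poly_Mapping.lookup h x"
    by (simp add: in_keys_iff)
  finally show "Poly_Mapping.lookup h x =
      Poly_Mapping.lookup (\<Sum>k\<in>Poly_Mapping.keys h. Poly_Mapping.single k (Poly_Mapping.lookup h k)) x"
    by (simp add: lookup_sum)
qed

lemma single_mult_eq:
  fixes g :: nsym
  shows "Poly_Mapping.single \<alpha> 1 * g = (\<Sum>k\<in>Poly_Mapping.keys g. Poly_Mapping.single (\<alpha> + k) (Poly_Mapping.lookup g k))"
  by (subst (1) poly_mapping_eq_sum_single[of g]) (simp add: sum_distrib_left mult_single)

section \<open>Left multiplication by H_r and its adjoint\<close>

lemma parts_Comp: "\<forall>x\<in>set xs. 0 < x \<Longrightarrow> parts (Comp xs) = xs"
  by (simp add: Comp_inverse)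

text \<open>The monomial that represents a composition uses the first variables in order, so a part
  put in front becomes the exponent of the first variable.\<close>

lemma M_coeff_part_add:
  assumes "0 < r" shows "M_coeff F (Comp [r] + \<alpha>) = M_coeff (xcoeff r F) \<alpha>"
  using assms by (simp add: M_coeff_def parts_Comp nth_Cons_eq_mcons)

lemma nsym_H_pos: "0 < r \<Longrightarrow> nsym_H (int r) = Poly_Mapping.single (Comp [r]) 1"
  by (simp add: nsym_H_def H_basis_def)

text \<open>This adjunction is the origin of the D_r in the adjoint of B_m.\<close>

lemma pairing_nsym_H_mult:
  assumes "0 < r"
  shows "pairing (nsym_H (int r) * g) F = pairing g (xcoeff r F)"
  using assms
  by (simp add: nsym_H_pos single_mult_eq pairing_sum_left pairing_single M_coeff_part_add pairing_def[of g])

lemma lookup_nsym_H_mult: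
  assumes "0 < r" "0 < b"
  shows "Poly_Mapping.lookup (nsym_H (int r) * g) (Comp [b] + \<beta>) = (if b = r then Poly_Mapping.lookup g \<beta> else 0)"
proof -
  have "Comp [r] + k = Comp [b] + \<beta> \<longleftrightarrow> b = r \<and> k = \<beta>" for k
    using assms by (auto simp: parts_inject[symmetric] parts_Comp)
  then have "Poly_Mapping.lookup (nsym_H (int r) * g) (Comp [b] + \<beta>) =
      (\<Sum>k\<in>Poly_Mapping.keys g. if k = \<beta> then (if b = r then Poly_Mapping.lookup g k else 0) else 0)"
    using assms by (auto simp: nsym_H_pos single_mult_eq lookup_sum lookup_single when_def intro!: sum.cong)
  then show ?thesis
    by (simp add: in_keys_iff)
qed

lemma lookup_nsym_H_mult_0:
  assumes "0 < r"
  shows "Poly_Mapping.lookup (nsym_H (int r) * g) 0 = 0"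
proof -
  have "Comp [r] + k \<noteq> 0" for k
    using assms by (auto simp: parts_inject[symmetric] parts_Comp)
  then show ?thesis
    using assms by (simp add: nsym_H_pos single_mult_eq lookup_sum lookup_single)
qed

section \<open>Existence of the adjoint operators\<close>

lemma finite_csize_le: "finite {\<alpha>. csize \<alpha> \<le> d}"
proof -
  have "{\<alpha>. csize \<alpha> \<le> d} = (\<Union>n\<le>d. {\<alpha>. csize \<alpha> = n})" by auto
  then show ?thesis by (simp add: finite_csize_eq)
qed

lemma ex_csize_bound: "\<exists>d. \<forall>\<alpha>\<in>Poly_Mapping.keys h. csize \<alpha> \<le> d"
  by (rule exI[of _ "\<Sum>\<alpha>\<in>Poly_Mapping.keys h. csize \<alpha>"]) (simp add: member_le_sum)

text \<open>Turns rational scalars into ring elements, so that linear combinations become sums of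
  products.\<close>

definition const_series :: "rat \<Rightarrow> power_series" where
  "const_series c = Series (\<lambda>m. if m = 0 then c else 0)"

lemma coeff_const_series_mult: "coeff (const_series c * F) m = c * coeff F m"
proof -
  have "coeff (const_series c * F) m = (\<Sum>(a, b) \<in> {(0, m)}. coeff (const_series c) a * coeff F b)"
    unfolding coeff_mult
    by (rule sum.mono_neutral_right) (auto simp: finite_splits const_series_def split: if_splits)
  then show ?thesis by (simp add: const_series_def)
qed

lemma coeff_qsym_M: "coeff (qsym_M \<beta>) m = (if exps m = \<beta> then 1 else 0)"
  by (simp add: qsym_M_def)

lemma qsym_M_in_QSym: "qsym_M \<beta> \<in> QSym"
  by (auto simp: QSym_def quasi_symmetric_def coeff_qsym_M csize_exps[symmetric] intro!: exI[of _ "csize \<beta>"])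

lemma QSym_eq_sum_qsym_M:
  assumes "quasi_symmetric G" "\<And>m. coeff G m \<noteq> 0 \<Longrightarrow> mdeg m \<le> d"
  shows "G = (\<Sum>\<beta> | csize \<beta> \<le> d. const_series (M_coeff G \<beta>) * qsym_M \<beta>)"
proof -
  have "coeff (\<Sum>\<beta> | csize \<beta> \<le> d. const_series (M_coeff G \<beta>) * qsym_M \<beta>) m = coeff G m" for m
  proof -
    have "coeff (\<Sum>\<beta> | csize \<beta> \<le> d. const_series (M_coeff G \<beta>) * qsym_M \<beta>) m =
        (\<Sum>\<beta> | csize \<beta> \<le> d. if exps m = \<beta> then M_coeff G \<beta> else 0)"
      by (simp add: coeff_sum coeff_const_series_mult coeff_qsym_M if_distrib cong: if_cong)
    also have "\<dots> = (if mdeg m \<le> d then coeff G m else 0)"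
      using coeff_eq_M_coeff[OF assms(1), of m] by (simp add: sum.delta' finite_csize_le csize_exps)
    finally show ?thesis
      using assms(2)[of m] by auto
  qed
  then show ?thesis by (simp add: power_series_eq_iff)
qed

lemma coeff_mult_qsym_M_deg: "coeff (F * qsym_M \<beta>) m \<noteq> 0 \<Longrightarrow> csize \<beta> \<le> mdeg m"
proof -
  assume "coeff (F * qsym_M \<beta>) m \<noteq> 0"
  then obtain a b where "a + b = m" "coeff (qsym_M \<beta>) b \<noteq> 0"
    unfolding coeff_mult split_def by (auto elim!: sum.not_neutral_contains_not_neutral)
  then show ?thesis
    by (auto simp: coeff_qsym_M csize_exps mdeg_add split: if_splits)
qed

lemma pairing_const_series_mult: "pairing h (const_series c * F) = c * pairing h F"
  by (simp add: pairing_def M_coeff_def coeff_const_series_mult sum_distrib_left mult.left_commute)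

lemma nsym_eqI:
  assumes "\<And>G. G \<in> QSym \<Longrightarrow> pairing h G = pairing h' G"
  shows "h = h'"
  using assms[OF qsym_M_in_QSym] by (intro poly_mapping_eqI) (simp add: pairing_qsym_M)

text \<open>The coefficient of \<open>h'\<close> at \<beta> is forced to be
  \<open>pairing h (F * qsym_M \<beta>)\<close>. It vanishes once the size of \<beta> exceeds the
  degree of \<open>h\<close>, because the product starts in degree \<open>csize \<beta>\<close>;
  hence \<open>h'\<close> has finite support.\<close>

lemma ex_perp: "\<exists>h'. \<forall>G\<in>QSym. pairing h' G = pairing h (F * G)"
proof -
  obtain d where d: "\<forall>\<alpha>\<in>Poly_Mapping.keys h. csize \<alpha> \<le> d"
    using ex_csize_bound by blast
  define h' where "h' = (\<Sum>\<beta> | csize \<beta> \<le> d. Poly_Mapping.single \<beta> (pairing h (F * qsym_M \<beta>)))"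
  have "pairing h' G = pairing h (F * G)" if G: "G \<in> QSym" for G
  proof -
    obtain e where e: "\<And>m. coeff G m \<noteq> 0 \<Longrightarrow> mdeg m \<le> e" and qs: "quasi_symmetric G"
      using G by (auto simp: QSym_def)
    \<comment> \<open>Expanding \<open>G\<close> takes degrees up to \<open>e\<close>, and
      \<open>h'\<close> is a sum over degrees up to \<open>d\<close>; the terms above
      \<open>d\<close> contribute 0.\<close>
    let ?D = "max d e"
    have "G = (\<Sum>\<beta> | csize \<beta> \<le> ?D. const_series (M_coeff G \<beta>) * qsym_M \<beta>)"
      by (rule QSym_eq_sum_qsym_M[OF qs]) (use e in \<open>simp add: le_max_iff_disj\<close>)
    then have "pairing h (F * G) = pairing h (\<Sum>\<beta> | csize \<beta> \<le> ?D. const_series (M_coeff G \<beta>) * (F * qsym_M \<beta>))"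
      by (metis (no_types, lifting) mult.left_commute sum.cong sum_distrib_left)
    also have "\<dots> = (\<Sum>\<beta> | csize \<beta> \<le> ?D. M_coeff G \<beta> * pairing h (F * qsym_M \<beta>))"
      by (simp add: pairing_sum_right pairing_const_series_mult)
    also have "\<dots> = (\<Sum>\<beta> | csize \<beta> \<le> d. M_coeff G \<beta> * pairing h (F * qsym_M \<beta>))"
    proof (rule sum.mono_neutral_right)
      show "\<forall>\<beta>\<in>{\<beta>. csize \<beta> \<le> ?D} - {\<beta>. csize \<beta> \<le> d}. M_coeff G \<beta> * pairing h (F * qsym_M \<beta>) = 0"
        using pairing_eq_0[OF d, of "F * qsym_M \<beta>" for \<beta>] coeff_mult_qsym_M_deg[of F]
        by (auto simp del: max_less_iff_conj) (meson le_less_trans not_le order_less_le_trans)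
    qed (auto simp: finite_csize_le)
    also have "\<dots> = pairing h' G"
      by (simp add: h'_def pairing_sum_left pairing_single mult.commute)
    finally show ?thesis ..
  qed
  then show ?thesis by blast
qed

lemma pairing_perp:
  assumes "G \<in> QSym" shows "pairing (perp F h) G = pairing h (F * G)"
proof -
  obtain h' where h': "\<forall>G\<in>QSym. pairing h' G = pairing h (F * G)"
    using ex_perp by blast
  have "\<forall>G\<in>QSym. pairing (perp F h) G = pairing h (F * G)"
    unfolding perp_def by (rule theI[of _ h']) (use h' in \<open>auto intro: nsym_eqI\<close>)
  with assms show ?thesis by blast
qed

lemma lookup_perp: "Poly_Mapping.lookup (perp F h) \<beta> = pairing h (F * qsym_M \<beta>)"
  by (simp add: pairing_qsym_M[symmetric] pairing_perp[OF qsym_M_in_QSym])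

lemma perp_one: "perp 1 h = h"
  by (rule poly_mapping_eqI) (simp add: lookup_perp pairing_qsym_M)

section \<open>Elementary symmetric functions and the Bernstein operators\<close>

lemma length_le_sum_list: "\<forall>x\<in>set xs. 0 < x \<Longrightarrow> length xs \<le> sum_list (xs :: nat list)"
  by (induction xs) auto

lemma eq_replicate_1:
  "\<forall>x\<in>set xs. 0 < x \<Longrightarrow> sum_list xs \<le> length xs \<Longrightarrow> xs = replicate (length xs) (1 :: nat)"
proof (induction xs)
  case (Cons x xs)
  then have "length xs \<le> sum_list xs"
    using length_le_sum_list by simp
  with Cons show ?case by auto
qed simp

lemma parts_ones: "parts (ones i) = replicate i 1"
  by (simp add: ones_def parts_Comp)

text \<open>Counting descents: for i > 0, refining \<open>ones i\<close> takes i - 1 descents, hence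
  at least i parts, and positive parts with sum i must then all be 1.\<close>

lemma finer_ones_iff: "finer \<beta> (ones i) \<longleftrightarrow> \<beta> = ones i"
proof
  assume fin: "finer \<beta> (ones i)"
  then have size: "sum_list (parts \<beta>) = i"
    by (simp add: finer_def csize_def parts_ones sum_list_replicate)
  have pos: "\<forall>x\<in>set (parts \<beta>). 0 < x"
    using parts[of \<beta>] by simp
  have "descent_set (ones i) = {0<..<i}"
    by (force simp: descent_set_def parts_ones sum_list_replicate min_def)
  moreover have "descent_set \<beta> = (\<lambda>j. sum_list (take j (parts \<beta>))) ` {0<..<length (parts \<beta>)}"
    by (auto simp: descent_set_def)
  ultimately have "{0<..<i} \<subseteq> (\<lambda>j. sum_list (take j (parts \<beta>))) ` {0<..<length (parts \<beta>)}"
    using fin by (simp add: finer_def)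
  then have "card {0<..<i} \<le> card {0<..<length (parts \<beta>)}"
    by (meson card_image_le card_mono finite_greaterThanLessThan finite_imageI order_trans)
  then have "i \<le> length (parts \<beta>)"
    using size by (cases "parts \<beta>") auto
  then have "parts \<beta> = replicate i 1"
    using eq_replicate_1[OF pos] length_le_sum_list[OF pos] size by simp
  then show "\<beta> = ones i"
    by (simp add: parts_inject[symmetric] parts_ones)
qed (simp add: finer_def)

text \<open>So \<open>fundamental (ones i)\<close> is the elementary symmetric function e_i.\<close>

lemma fundamental_ones: "fundamental (ones i) = qsym_M (ones i)"
  by (simp add: fundamental_def finer_ones_iff)

lemma coeff_fundamental_ones: "coeff (fundamental (ones i)) m = (if parts (exps m) = replicate i 1 then 1 else 0)"
  by (auto simp: fundamental_ones coeff_qsym_M parts_inject[symmetric] parts_ones)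

lemma exps_eq_Nil_iff: "parts (exps m) = [] \<longleftrightarrow> m = 0"
proof
  assume "parts (exps m) = []"
  then have "mdeg m = 0" by (simp add: csize_def flip: csize_exps)
  then show "m = 0" by (simp add: mdeg_eq_0_iff)
qed (simp add: parts_exps)

lemma fundamental_ones_0: "fundamental (ones 0) = 1"
  by (simp add: power_series_eq_iff coeff_fundamental_ones coeff_one exps_eq_Nil_iff)

text \<open>The identity e_i(t, x) = e_i(x) + t e_(i-1)(x), read off coefficientwise.\<close>

lemma xcoeff_fundamental_ones:
  "xcoeff s (fundamental (ones i)) =
    (if s = 0 then fundamental (ones i) else if s = 1 \<and> 0 < i then fundamental (ones (i - 1)) else 0)"
  by (cases i) (auto simp: power_series_eq_iff coeff_fundamental_ones parts_exps_mcons)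

lemma perp_fundamental_ones_eq_0:
  assumes "\<forall>\<alpha>\<in>Poly_Mapping.keys h. csize \<alpha> \<le> d" "d < i"
  shows "perp (fundamental (ones i)) h = 0"
proof (rule poly_mapping_eqI)
  fix \<beta>
  have "i \<le> mdeg m" if "coeff (fundamental (ones i) * qsym_M \<beta>) m \<noteq> 0" for m
    using coeff_mult_qsym_M_deg[of "qsym_M \<beta>" "ones i" m] that
    by (simp add: fundamental_ones mult.commute csize_def parts_ones sum_list_replicate)
  then show "Poly_Mapping.lookup (perp (fundamental (ones i)) h) \<beta> = Poly_Mapping.lookup 0 \<beta>"
    unfolding lookup_perp using pairing_eq_0[OF assms(1)] assms(2) by (simp add: order_less_le_trans)
qed

text \<open>The limit \<open>N\<close> is left free because it must later bound the indices in a
  determinant as well.\<close>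

lemma bernstein_eq_sum:
  assumes "\<forall>\<alpha>\<in>Poly_Mapping.keys h. csize \<alpha> \<le> d" "d \<le> N"
  shows "bernstein m h = (\<Sum>i\<le>N. (-1) ^ i * nsym_H (m + int i) * perp (fundamental (ones i)) h)"
  unfolding bernstein_def
proof (rule Sum_any.expand_superset)
  have "i \<le> N" if "(-1) ^ i * nsym_H (m + int i) * perp (fundamental (ones i)) h \<noteq> 0" for i
    using perp_fundamental_ones_eq_0[OF assms(1), of i] assms(2) that by (cases "i \<le> N") auto
  then show "{i. (-1) ^ i * nsym_H (m + int i) * perp (fundamental (ones i)) h \<noteq> 0} \<subseteq> {..N}"
    by auto
qed simp

lemma xcoeff_in_QSym:
  assumes "G \<in> QSym" "0 < r" shows "xcoeff r G \<in> QSym"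
proof -
  obtain d where d: "\<And>m. coeff G m \<noteq> 0 \<Longrightarrow> mdeg m \<le> d"
    using assms by (auto simp: QSym_def)
  have "quasi_symmetric (xcoeff r G)"
    using assms by (auto simp: QSym_def quasi_symmetric_def parts_inject[symmetric] parts_exps_mcons)
  moreover have "mdeg m \<le> d" if "coeff (xcoeff r G) m \<noteq> 0" for m
    using d[of "mcons r m"] that by simp
  ultimately show ?thesis by (auto simp: QSym_def)
qed

text \<open>For positive \<open>m\<close> every index m + i is positive, so each H is a single
  letter with adjoint \<open>xcoeff (m + i)\<close>.\<close>

lemma pairing_bernstein:
  assumes "\<forall>\<alpha>\<in>Poly_Mapping.keys h. csize \<alpha> \<le> d" "d \<le> N" "0 < m" "G \<in> QSym"
  shows "pairing (bernstein (int m) h) G =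
    pairing h (\<Sum>i\<le>N. (-1) ^ i * (fundamental (ones i) * xcoeff (m + i) G))"
proof -
  have "pairing (bernstein (int m) h) G =
      (\<Sum>i\<le>N. (-1) ^ i * pairing (nsym_H (int (m + i)) * perp (fundamental (ones i)) h) G)"
    by (subst bernstein_eq_sum[OF assms(1,2)])
      (simp_all add: pairing_sum_left mult.assoc pairing_minus_one_power_left)
  also have "\<dots> = (\<Sum>i\<le>N. (-1) ^ i * pairing h (fundamental (ones i) * xcoeff (m + i) G))"
    using assms(3,4) by (simp only: pairing_nsym_H_mult pairing_perp xcoeff_in_QSym add_pos_nonneg zero_le)
  finally show ?thesis
    by (simp add: pairing_sum_right pairing_minus_one_power_right)
qed

text \<open>The coefficient form of E(-u) H(u) = 1. Setting the first variable to 0 preserves the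
  sum up to renumbering, and every positive power of that variable has coefficient 0; so the sum
  equals its constant term.\<close>

lemma sum_fundamental_ones_hser:
  assumes "K \<le> int N"
  shows "(\<Sum>i\<le>N. (-1) ^ i * (fundamental (ones i) * hser (K - int i))) = (if K = 0 then 1 else 0)"
proof -
  define P where "P = (\<lambda>K N. \<Sum>i\<le>N. (-1) ^ i * (fundamental (ones i) * hser (K - int i)))"
  have X0: "xcoeff 0 (P K N) = P K N"
  proof -
    have "xcoeff 0 (P K N) = (\<Sum>i\<le>N. (-1) ^ i * xcoeff 0 (fundamental (ones i) * hser (K - int i)))"
      by (simp add: power_series_eq_iff P_def coeff_sum coeff_minus_one_power)
    then show ?thesis
      by (simp add: xcoeff_mult xcoeff_fundamental_ones P_def)
  qed
  have XS: "xcoeff (Suc r) (P K N) = 0" for r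
  proof -
    have t: "xcoeff (Suc r) (fundamental (ones i) * hser (K - int i)) =
        fundamental (ones i) * hser (K - int (Suc r) - int i) +
        (if 0 < i then fundamental (ones (i - 1)) * hser (K - int (Suc r) - int (i - 1)) else 0)" for i
    proof -
      have "xcoeff (Suc r) (fundamental (ones i) * hser (K - int i)) =
          (\<Sum>s\<in>{0, 1}. xcoeff s (fundamental (ones i)) * xcoeff (Suc r - s) (hser (K - int i)))"
        unfolding xcoeff_mult by (rule sum.mono_neutral_right) (auto simp: xcoeff_fundamental_ones)
      then show ?thesis
        by (auto simp: xcoeff_fundamental_ones of_nat_diff algebra_simps)
    qed
    have "xcoeff (Suc r) (P K N) = (\<Sum>i\<le>N. (-1) ^ i * xcoeff (Suc r) (fundamental (ones i) * hser (K - int i)))"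
      by (simp add: power_series_eq_iff P_def coeff_sum coeff_minus_one_power)
    also have "\<dots> = P (K - int (Suc r)) N +
        (\<Sum>i\<le>N. if 0 < i then (-1) ^ i * (fundamental (ones (i - 1)) * hser (K - int (Suc r) - int (i - 1))) else 0)"
      unfolding t distrib_left sum.distrib P_def by (intro arg_cong2[of _ _ _ _ "(+)"] sum.cong) auto
    also have "(\<Sum>i\<le>N. if 0 < i then (-1) ^ i * (fundamental (ones (i - 1)) * hser (K - int (Suc r) - int (i - 1))) else 0)
        = - (\<Sum>i<N. (-1) ^ i * (fundamental (ones i) * hser (K - int (Suc r) - int i)))"
      by (subst lessThan_Suc_atMost[symmetric], subst sum.lessThan_Suc_shift) (simp add: sum_negf)
    \<comment> \<open>The two sums differ by the term i = N alone, whose h has negative index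
      because K \<le> N.\<close>
    also have "P (K - int (Suc r)) N + \<dots> = 0"
      using assms by (cases N) (simp_all add: P_def hser_neg lessThan_Suc_atMost)
    finally show ?thesis .
  qed
  have "coeff (P K N) m = coeff (if K = 0 then 1 else 0) m" for m
  proof (induction m rule: monomial_mcons_induct)
    case zero
    \<comment> \<open>For i > 0 the function e_i has no constant term.\<close>
    have "coeff (P K N) 0 = (\<Sum>i\<le>N. if i = 0 then coeff (hser K) 0 else 0)"
      unfolding P_def coeff_sum coeff_minus_one_power coeff_mult_0 coeff_fundamental_ones
        exps_eq_Nil_iff[of 0, THEN iffD2, OF refl]
      by (intro sum.cong) (auto simp: coeff_one)
    also have "\<dots> = coeff (hser K) 0"
      by simp
    finally show ?case
      by (cases "K = 0") (simp_all add: coeff_hser coeff_one)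
  next
    case (mcons r m)
    show ?case
    proof (cases r)
      case 0
      have "coeff (P K N) (mcons 0 m) = coeff (P K N) m"
        using X0 by (metis coeff_xcoeff)
      with 0 mcons show ?thesis by (auto simp: coeff_one)
    next
      case (Suc s)
      have "coeff (P K N) (mcons (Suc s) m) = 0"
        using XS by (metis coeff_xcoeff coeff_zero)
      with Suc show ?thesis by (auto simp: coeff_one)
    qed
  qed
  then show ?thesis
    unfolding power_series_eq_iff P_def by blast
qed

section \<open>Immaculate functions\<close>

text \<open>In the Laplace expansion only the factor h_(a_l - r) depends on r. The alternating sum
  therefore acts on that factor, with K = a_l - m, and annihilates every row in which K is
  nonzero.\<close>

lemma sum_fundamental_ones_jt:
  assumes "0 < m" "\<And>l. l < Suc k \<Longrightarrow> a l - int m \<le> int N"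
  shows "(\<Sum>i\<le>N. (-1) ^ i * (fundamental (ones i) * xcoeff (m + i) (jt (Suc k) a))) =
    (\<Sum>l<Suc k. (-1) ^ l * (if a l = int m then jt k (skip l a) else 0))"
proof -
  have x: "xcoeff r (jt (Suc k) a) = (\<Sum>l<Suc k. (-1) ^ l * (hser (a l - int r) * jt k (skip l a)))" for r
  proof -
    have "fps_nth ((-1) ^ l * xfps (hser (a l)) * fps_const (jt k (skip l a))) r =
        (-1) ^ l * (hser (a l - int r) * jt k (skip l a))" for l
      by (cases "even l") (simp_all add: fps_mult_right_const_nth)
    then show ?thesis
      by (simp only: xfps_nth[symmetric] xfps_jt_expand fps_sum_nth)
  qed
  have "(\<Sum>i\<le>N. (-1) ^ i * (fundamental (ones i) * xcoeff (m + i) (jt (Suc k) a))) =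
      (\<Sum>i\<le>N. \<Sum>l<Suc k. (-1) ^ l * jt k (skip l a) * ((-1) ^ i * (fundamental (ones i) * hser ((a l - int m) - int i))))"
    unfolding x sum_distrib_left by (intro sum.cong refl) (simp add: algebra_simps)
  also have "\<dots> = (\<Sum>l<Suc k. (-1) ^ l * jt k (skip l a) * (\<Sum>i\<le>N. (-1) ^ i * (fundamental (ones i) * hser ((a l - int m) - int i))))"
    unfolding sum_distrib_left by (rule sum.swap)
  also have "\<dots> = (\<Sum>l<Suc k. (-1) ^ l * (if a l = int m then jt k (skip l a) else 0))"
    using assms(2) by (intro sum.cong refl) (simp add: sum_fundamental_ones_hser)
  finally show ?thesis .
qed

lemma jt_0 [simp]: "jt 0 a = 1"
  by (simp add: jt_def)

lemma pairing_one: "pairing 1 F = coeff F 0"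
  using pairing_single[of 0 1 F] by (simp add: M_coeff_def)

text \<open>A positive first index puts a row of positive degree into the determinant.\<close>

lemma coeff_jt_0_eq_0:
  assumes "0 < a 0" shows "coeff (jt (Suc k) a) 0 = 0"
proof -
  have "coeff (\<Prod>i<Suc k. hser (a i + int (p i))) 0 = 0" for p
    unfolding coeff_prod_0 using assms by (intro prod_zero bexI[of _ 0]) (auto simp: coeff_hser)
  then show ?thesis
    unfolding jt_def det_mat coeff_sum by (intro sum.neutral) (simp add: coeff_mult_0)
qed

text \<open>The operator adjoint to \<open>bernstein (int x)\<close> deletes the row \<open>l\<close> with \<open>a l = x\<close>, so the pairing
  satisfies the Laplace recursion along the first row of the matrix on the right.\<close>

lemma pairing_foldr_bernstein_jt:
  assumes "\<forall>x\<in>set xs. 0 < x" "\<And>i. i < k \<Longrightarrow> 0 < a i + int i"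
  shows "pairing (foldr (\<lambda>x. bernstein (int x)) xs 1) (jt k a) =
    (if length xs = k then det (mat k k (\<lambda>(i, j). if int (xs ! i) = a j + int i then 1 else 0)) else 0)"
  using assms
proof (induction xs arbitrary: k a)
  case Nil
  show ?case
  proof (cases k)
    \<comment> \<open>Rows remain after the composition is exhausted; pairing with 1 takes the
      constant term of the determinant.\<close>
    case (Suc k')
    then show ?thesis
      using Nil(2)[of 0] by (simp add: pairing_one coeff_jt_0_eq_0)
  qed (simp add: pairing_one coeff_one)
next
  case (Cons x xs)
  define h where "h = foldr (\<lambda>x. bernstein (int x)) xs 1"
  have x: "0 < x" using Cons.prems by simp
  obtain d where d: "\<forall>\<alpha>\<in>Poly_Mapping.keys h. csize \<alpha> \<le> d"
    using ex_csize_bound by blast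
  show ?case
  proof (cases k)
    case 0
    \<comment> \<open>Parts remain but no rows: the empty determinant is 1 and contains no positive
      power of the first variable.\<close>
    have "xcoeff (x + i) 1 = 0" for i
      using x by (simp add: power_series_eq_iff coeff_one)
    then have "pairing (bernstein (int x) h) (jt 0 a) = 0"
      using pairing_bernstein[OF d order_refl x jt_in_QSym[of 0 a]] by simp
    then show ?thesis using 0 by (simp add: h_def)
  next
    case (Suc k')
    \<comment> \<open>Large enough both for the degree of \<open>h\<close> and for all
      \<open>a l - int x\<close>, so that no alternating sum is cut short.\<close>
    define N where "N = d + (\<Sum>l<Suc k'. nat (a l))"
    have N: "a l - int x \<le> int N" if "l < Suc k'" for l
    proof -
      have "nat (a l) \<le> (\<Sum>l<Suc k'. nat (a l))"
        by (rule member_le_sum) (use that in auto)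
      then have "nat (a l) \<le> N" by (simp only: N_def trans_le_add2)
      then show ?thesis by linarith
    qed
    let ?M = "mat (Suc k') (Suc k') (\<lambda>(i, j). if int ((x # xs) ! i) = a j + int i then 1 else 0 :: rat)"
    have "pairing (bernstein (int x) h) (jt (Suc k') a) =
        pairing h (\<Sum>i\<le>N. (-1) ^ i * (fundamental (ones i) * xcoeff (x + i) (jt (Suc k') a)))"
      by (rule pairing_bernstein[OF d _ x jt_in_QSym]) (simp add: N_def)
    also have "\<dots> = (\<Sum>l<Suc k'. (-1) ^ l * (if a l = int x then pairing h (jt k' (skip l a)) else 0))"
      by (subst sum_fundamental_ones_jt[OF x], erule N) (simp only: pairing_sum_right pairing_minus_one_power_right if_distrib[of "pairing h"] pairing_zero_right)
    also have "\<dots> = (\<Sum>l<Suc k'. (-1) ^ l * (if a l = int x then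
        (if length xs = k' then det (mat k' k' (\<lambda>(i, j). if int (xs ! i) = skip l a j + int i then 1 else 0)) else 0) else 0))"
    proof (intro sum.cong refl arg_cong2[of _ _ _ _ "(*)"] if_cong)
      fix l assume "l \<in> {..<Suc k'}"
      \<comment> \<open>A row before \<open>l\<close> gains 1 from the column shift; a later row
        moves up one place, and the shift compensates for this.\<close>
      have "0 < skip l a i + int i" if "i < k'" for i
        using Cons.prems(2)[of i] Cons.prems(2)[of "Suc i"] that Suc by (auto simp: skip_def)
      then show "pairing h (jt k' (skip l a)) =
          (if length xs = k' then det (mat k' k' (\<lambda>(i, j). if int (xs ! i) = skip l a j + int i then 1 else 0)) else 0)"
        unfolding h_def using Cons.prems(1) by (intro Cons.IH) auto
    qed
    \<comment> \<open>The columns of \<open>?M\<close> correspond to the rows of \<open>jt\<close>,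
      so deleting row \<open>l\<close> there is deleting column \<open>l\<close> here, in an
      expansion along the first row.\<close>
    also have "\<dots> = (if length xs = k' then \<Sum>l<Suc k'. ?M $$ (0, l) * cofactor ?M 0 l else 0)"
    proof (cases "length xs = k'")
      case True
      have "mat_delete ?M 0 l = mat k' k' (\<lambda>(i, j). if int (xs ! i) = skip l a j + int i then 1 else 0)"
        if "l < Suc k'" for l
        using that by (intro eq_matI) (auto simp: mat_delete_def skip_def algebra_simps)
      with True show ?thesis
        by (auto simp: cofactor_def intro!: sum.cong)
    qed (auto intro!: sum.neutral)
    also have "(\<Sum>l<Suc k'. ?M $$ (0, l) * cofactor ?M 0 l) = det ?M"
      by (rule laplace_expansion_row[symmetric]) auto
    finally show ?thesis
      using Suc by (simp add: h_def)
  qed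
qed

lemma pairing_immaculate_jt:
  assumes "\<And>i. i < k \<Longrightarrow> 0 < a i + int i"
  shows "pairing (immaculate \<alpha>) (jt k a) =
    (if length (parts \<alpha>) = k then
      \<Sum>\<sigma> | \<sigma> permutes {..<k} \<and> (\<forall>i<k. int (parts \<alpha> ! i) = a (\<sigma> i) + int i). of_int (sign \<sigma>) else 0)"
proof -
  have "(\<Prod>i<k. if int (parts \<alpha> ! i) = a (p i) + int i then 1 else 0 :: rat) =
      (if \<forall>i<k. int (parts \<alpha> ! i) = a (p i) + int i then 1 else 0)" for p
    by (auto intro: prod_zero)
  then have "det (mat k k (\<lambda>(i, j). if int (parts \<alpha> ! i) = a j + int i then 1 else 0 :: rat)) =
      (\<Sum>p | p permutes {..<k}. if \<forall>i<k. int (parts \<alpha> ! i) = a (p i) + int i then of_int (sign p) else 0)"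
    unfolding det_mat by (auto simp: atLeast0LessThan intro!: sum.cong)
  also have "\<dots> = (\<Sum>\<sigma> | \<sigma> permutes {..<k} \<and> (\<forall>i<k. int (parts \<alpha> ! i) = a (\<sigma> i) + int i). of_int (sign \<sigma>))"
    by (subst sum.inter_filter[symmetric]) (simp_all add: finite_permutations)
  finally show ?thesis
    unfolding immaculate_def using pairing_foldr_bernstein_jt[of "parts \<alpha>" k a] parts[of \<alpha>] assms by simp
qed

section \<open>Unitriangularity over the H basis\<close>

lemma lookup_bernstein:
  assumes "0 < m"
  shows "Poly_Mapping.lookup (bernstein (int m) h) 0 = 0"
    and "0 < b \<Longrightarrow> b < m \<Longrightarrow> Poly_Mapping.lookup (bernstein (int m) h) (Comp [b] + \<beta>) = 0"
    and "Poly_Mapping.lookup (bernstein (int m) h) (Comp [m] + \<beta>) = Poly_Mapping.lookup h \<beta>"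
proof -
  obtain d where d: "\<forall>\<alpha>\<in>Poly_Mapping.keys h. csize \<alpha> \<le> d"
    using ex_csize_bound by blast
  have signs: "Poly_Mapping.lookup ((-1) ^ i * g) \<alpha> = (-1) ^ i * Poly_Mapping.lookup g \<alpha>" for i and g :: nsym and \<alpha>
    by (cases "even i") auto
  \<comment> \<open>Term i is supported on compositions with first part m + i. So no first part is
    below \<open>m\<close>, and \<open>m\<close> itself comes only from i = 0, where
    \<open>perp\<close> is the identity.\<close>
  have B: "Poly_Mapping.lookup (bernstein (int m) h) \<alpha> =
      (\<Sum>i\<le>d. (-1) ^ i * Poly_Mapping.lookup (nsym_H (int (m + i)) * perp (fundamental (ones i)) h) \<alpha>)" for \<alpha>
    by (subst bernstein_eq_sum[OF d order_refl]) (simp add: lookup_sum mult.assoc signs)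
  show "Poly_Mapping.lookup (bernstein (int m) h) 0 = 0"
    unfolding B using assms by (intro sum.neutral) (simp add: lookup_nsym_H_mult_0 del: of_nat_add)
  show "Poly_Mapping.lookup (bernstein (int m) h) (Comp [b] + \<beta>) = 0" if "0 < b" "b < m"
    unfolding B using assms that by (intro sum.neutral) (simp add: lookup_nsym_H_mult del: of_nat_add)
  have "Poly_Mapping.lookup (bernstein (int m) h) (Comp [m] + \<beta>) =
      (\<Sum>i\<le>d. if i = 0 then Poly_Mapping.lookup h \<beta> else 0)"
    unfolding B using assms
    by (intro sum.cong) (auto simp: lookup_nsym_H_mult fundamental_ones_0 perp_one simp del: of_nat_add)
  then show "Poly_Mapping.lookup (bernstein (int m) h) (Comp [m] + \<beta>) = Poly_Mapping.lookup h \<beta>"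
    by simp
qed

lemma Comp_Cons: "\<forall>x\<in>set (b # bs). 0 < x \<Longrightarrow> Comp (b # bs) = Comp [b] + Comp bs"
  by (simp add: parts_inject[symmetric] parts_Comp)

definition lex_less :: "composition \<Rightarrow> composition \<Rightarrow> bool" where
  "lex_less \<alpha> \<beta> \<longleftrightarrow> (parts \<alpha>, parts \<beta>) \<in> lexord {(x, y). x < y}"

lemma transp_lex_less: "transp lex_less"
  unfolding lex_less_def
  by (intro transpI) (rule lexord_trans, auto simp: trans_def)

lemma lex_less_irrefl: "\<not> lex_less \<alpha> \<alpha>"
  unfolding lex_less_def by (rule lexord_irreflexive) simp

text \<open>A first part never drops below \<open>x\<close>. If it equals \<open>x\<close>, the
  coefficient is that of the tails and the comparison continues there, which is the lexicographic
  order.\<close>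

lemma lookup_foldr_bernstein:
  assumes "\<forall>x\<in>set xs. 0 < x"
  shows "Poly_Mapping.lookup (foldr (\<lambda>x. bernstein (int x)) xs 1) (Comp xs) = 1"
    and "\<forall>y\<in>set ys. 0 < y \<Longrightarrow> Poly_Mapping.lookup (foldr (\<lambda>x. bernstein (int x)) xs 1) (Comp ys) \<noteq> 0 \<Longrightarrow>
      xs = ys \<or> (xs, ys) \<in> lexord {(x, y). x < y}"
  using assms
proof (induction xs arbitrary: ys)
  case Nil
  {
    case 1 show ?case by (simp add: lookup_one zero_composition_def)
  next
    case 2
    then have "Comp ys = Comp []"
      by (auto simp: lookup_one when_def zero_composition_def split: if_splits)
    then show ?case using 2 parts_Comp[of ys] parts_Comp[of "[]"] by simp
  }
next
  case (Cons x xs)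
  {
    case 1 then show ?case
      using Cons.IH(1) Comp_Cons[of x xs] by (simp add: lookup_bernstein(3))
  next
    case 2
    then have x: "0 < x" by simp
    show ?case
    proof (cases ys)
      case Nil
      then show ?thesis
        using 2 lookup_bernstein(1)[OF x] by (simp add: zero_composition_def)
    next
      case (Cons b bs)
      then have Cb: "Comp ys = Comp [b] + Comp bs" and b: "0 < b"
        using 2 Comp_Cons[of b bs] by simp_all
      then have "\<not> b < x"
        using 2 lookup_bernstein(2)[OF x b] by auto
      moreover have "xs = bs \<or> (xs, bs) \<in> lexord {(x, y). x < y}" if "b = x"
        using 2 Cons Cb that x by (intro Cons.IH(2)) (auto simp: lookup_bernstein(3))
      ultimately show ?thesis
        unfolding Cons by auto
    qed
  }
qed

lemma lookup_immaculate_self: "Poly_Mapping.lookup (immaculate \<alpha>) \<alpha> = 1"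
  using lookup_foldr_bernstein(1)[of "parts \<alpha>"] parts[of \<alpha>] by (simp add: immaculate_def parts_inverse)

lemma lookup_immaculate_nonzero:
  "Poly_Mapping.lookup (immaculate \<alpha>) \<beta> \<noteq> 0 \<Longrightarrow> \<alpha> = \<beta> \<or> lex_less \<alpha> \<beta>"
  using lookup_foldr_bernstein(2)[of "parts \<alpha>" "parts \<beta>"] parts[of \<alpha>] parts[of \<beta>]
  by (simp add: immaculate_def parts_inverse lex_less_def parts_inject)

text \<open>Remove a minimal element \<open>a\<close>. By triangularity its unknown occurs in no
  other equation, so the smaller system is solved first and row \<open>a\<close>, with diagonal
  entry 1, then determines the value at \<open>a\<close>. Solvability yields the dual functions,
  uniqueness yields comparison of coordinates.\<close>

lemma unitriangular_system:
  fixes L :: "'a \<Rightarrow> 'a \<Rightarrow> 'b::comm_ring_1"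
  assumes "finite A" "transp R" "\<And>x. \<not> R x x"
    and "\<And>x. x \<in> A \<Longrightarrow> L x x = 1"
    and "\<And>x y. x \<in> A \<Longrightarrow> y \<in> A \<Longrightarrow> L x y \<noteq> 0 \<Longrightarrow> x = y \<or> R x y"
  shows "(\<exists>f. \<forall>x\<in>A. (\<Sum>y\<in>A. L x y * f y) = g x) \<and>
    (\<forall>f. (\<forall>x\<in>A. (\<Sum>y\<in>A. L x y * f y) = 0) \<longrightarrow> (\<forall>x\<in>A. f x = 0))"
  using assms(1,4,5)
proof (induction A rule: finite_psubset_induct)
  case (psubset A)
  show ?case
  proof (cases "A = {}")
    case False
    have "asymp R"
      using assms(2,3) by (metis asympI transpD)
    then obtain a where a: "a \<in> A" and min: "\<And>x. x \<in> A \<Longrightarrow> x \<noteq> a \<Longrightarrow> \<not> R x a"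
      using Finite_Set.bex_min_element[OF psubset.hyps(1) _ _ False, of R] assms(2)
      by (metis asymp_on_subset subset_UNIV transp_on_subset)
    let ?B = "A - {a}"
    have La: "L x a = 0" if "x \<in> ?B" for x
      using psubset.prems(2)[of x a] min[of x] a that by auto
    have split: "(\<Sum>y\<in>A. L x y * f y) = L x a * f a + (\<Sum>y\<in>?B. L x y * f y)" for f x
      by (rule sum.remove[OF psubset.hyps(1) a])
    have IH: "(\<exists>f. \<forall>x\<in>?B. (\<Sum>y\<in>?B. L x y * f y) = g x) \<and>
        (\<forall>f. (\<forall>x\<in>?B. (\<Sum>y\<in>?B. L x y * f y) = 0) \<longrightarrow> (\<forall>x\<in>?B. f x = 0))"
      by (rule psubset.IH) (use a psubset.prems in auto)
    then obtain f where f: "\<And>x. x \<in> ?B \<Longrightarrow> (\<Sum>y\<in>?B. L x y * f y) = g x" by blast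
    define f' where "f' = f(a := g a - (\<Sum>y\<in>?B. L a y * f y))"
    have ff: "(\<Sum>y\<in>?B. L x y * f' y) = (\<Sum>y\<in>?B. L x y * f y)" for x
      by (intro sum.cong) (auto simp: f'_def)
    have "(\<Sum>y\<in>A. L x y * f' y) = g x" if "x \<in> A" for x
    proof (cases "x = a")
      case True
      then show ?thesis
        unfolding split ff using psubset.prems(1)[OF a] by (simp add: f'_def)
    next
      case False
      with that show ?thesis
        unfolding split ff using La[of x] f[of x] by simp
    qed
    moreover have "\<forall>x\<in>A. u x = 0" if u: "\<forall>x\<in>A. (\<Sum>y\<in>A. L x y * u y) = 0" for u
    proof -
      have "(\<Sum>y\<in>?B. L x y * u y) = 0" if "x \<in> ?B" for x
      proof -
        have "L x a * u a + (\<Sum>y\<in>?B. L x y * u y) = 0"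
          using u that unfolding split by blast
        then show ?thesis by (simp add: La[OF that])
      qed
      then have B: "\<forall>x\<in>?B. u x = 0"
        using IH by blast
      have "L a a * u a + (\<Sum>y\<in>?B. L a y * u y) = 0"
        using u a unfolding split by blast
      moreover have "(\<Sum>y\<in>?B. L a y * u y) = 0"
        using B by (intro sum.neutral) simp
      ultimately have "u a = 0"
        using psubset.prems(1)[OF a] by simp
      with B show ?thesis by blast
    qed
    ultimately show ?thesis by blast
  qed simp
qed

section \<open>The dual basis\<close>

lemma M_coeff_QSym_hom:
  assumes "F \<in> QSym_hom n" "csize \<alpha> \<noteq> n" shows "M_coeff F \<alpha> = 0"
proof (rule ccontr)
  assume "M_coeff F \<alpha> \<noteq> 0"
  then have "mdeg (Poly_Mapping.nth (parts \<alpha>)) = n"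
    using assms by (simp add: QSym_hom_def M_coeff_def)
  with assms show False by (simp add: mdeg_nth_parts)
qed

text \<open>Confines the pairing to the finite index set on which the unitriangular system is
  square.\<close>

lemma pairing_QSym_hom:
  assumes "F \<in> QSym_hom n"
  shows "pairing h F = (\<Sum>\<alpha> | csize \<alpha> = n. Poly_Mapping.lookup h \<alpha> * M_coeff F \<alpha>)"
proof -
  have "pairing h F = (\<Sum>\<alpha>\<in>Poly_Mapping.keys h \<union> {\<alpha>. csize \<alpha> = n}. Poly_Mapping.lookup h \<alpha> * M_coeff F \<alpha>)"
    by (rule pairing_superset) (auto simp: finite_csize_eq)
  also have "\<dots> = (\<Sum>\<alpha> | csize \<alpha> = n. Poly_Mapping.lookup h \<alpha> * M_coeff F \<alpha>)"
    by (rule sum.mono_neutral_right) (auto simp: finite_csize_eq M_coeff_QSym_hom[OF assms])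
  finally show ?thesis .
qed

lemma QSym_hom_add:
  assumes "F \<in> QSym_hom n" "G \<in> QSym_hom n" shows "F + G \<in> QSym_hom n"
proof -
  have "quasi_symmetric (F + G)"
    using assms unfolding QSym_hom_def quasi_symmetric_def mem_Collect_eq coeff_add by metis
  moreover have "mdeg m = n" if "coeff (F + G) m \<noteq> 0" for m
    using assms that unfolding QSym_hom_def mem_Collect_eq coeff_add by (metis add.right_neutral)
  ultimately show ?thesis by (simp add: QSym_hom_def)
qed

lemma QSym_hom_uminus: "F \<in> QSym_hom n \<Longrightarrow> - F \<in> QSym_hom n"
  unfolding QSym_hom_def quasi_symmetric_def mem_Collect_eq coeff_uminus neg_equal_iff_equal neg_equal_0_iff_equal
  by assumption

lemma QSym_hom_zero: "0 \<in> QSym_hom n"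
  by (simp add: QSym_hom_def quasi_symmetric_def)

lemma QSym_hom_sum: "(\<And>i. i \<in> A \<Longrightarrow> f i \<in> QSym_hom n) \<Longrightarrow> sum f A \<in> QSym_hom n"
  by (induction A rule: infinite_finite_induct) (auto simp: QSym_hom_add QSym_hom_zero)

text \<open>The differences of the M coefficients solve the homogeneous unitriangular system, so
  they vanish.\<close>

lemma QSym_hom_eqI:
  assumes F: "F \<in> QSym_hom n" and G: "G \<in> QSym_hom n"
    and eq: "\<And>\<alpha>. csize \<alpha> = n \<Longrightarrow> pairing (immaculate \<alpha>) F = pairing (immaculate \<alpha>) G"
  shows "F = G"
proof -
  let ?A = "{\<alpha>. csize \<alpha> = n}"
  have "\<forall>f. (\<forall>x\<in>?A. (\<Sum>y\<in>?A. Poly_Mapping.lookup (immaculate x) y * f y) = 0) \<longrightarrow> (\<forall>x\<in>?A. f x = 0)"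
    using unitriangular_system[of ?A lex_less "\<lambda>\<alpha>. Poly_Mapping.lookup (immaculate \<alpha>)"]
      finite_csize_eq transp_lex_less lex_less_irrefl lookup_immaculate_self lookup_immaculate_nonzero
    by blast
  moreover have "(\<Sum>\<beta>\<in>?A. Poly_Mapping.lookup (immaculate \<alpha>) \<beta> * (M_coeff F \<beta> - M_coeff G \<beta>)) = 0" if "\<alpha> \<in> ?A" for \<alpha>
    using eq[of \<alpha>] that by (simp add: pairing_QSym_hom[OF F] pairing_QSym_hom[OF G] right_diff_distrib sum_subtractf)
  ultimately have "M_coeff F \<beta> = M_coeff G \<beta>" if "csize \<beta> = n" for \<beta>
    using that by fastforce
  then have "M_coeff F \<beta> = M_coeff G \<beta>" for \<beta>
    using M_coeff_QSym_hom[OF F] M_coeff_QSym_hom[OF G] by (cases "csize \<beta> = n") auto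
  then show ?thesis
    using F G coeff_eq_M_coeff[of F] coeff_eq_M_coeff[of G] by (simp add: QSym_hom_def power_series_eq_iff)
qed

lemma dual_immaculate_spec:
  "dual_immaculate \<beta> \<in> QSym_hom (csize \<beta>) \<and>
    (\<forall>\<alpha>. csize \<alpha> = csize \<beta> \<longrightarrow> pairing (immaculate \<alpha>) (dual_immaculate \<beta>) = (if \<alpha> = \<beta> then 1 else 0))"
  unfolding dual_immaculate_def
proof (rule theI')
  let ?n = "csize \<beta>"
  let ?A = "{\<alpha>. csize \<alpha> = ?n}"
  let ?P = "\<lambda>F. F \<in> QSym_hom ?n \<and> (\<forall>\<alpha>. csize \<alpha> = ?n \<longrightarrow> pairing (immaculate \<alpha>) F = (if \<alpha> = \<beta> then 1 else 0))"
  \<comment> \<open>The numbers \<open>f\<close> are to be the coefficients of the dual function in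
    the monomial basis.\<close>
  obtain f where f: "\<And>\<alpha>. \<alpha> \<in> ?A \<Longrightarrow>
      (\<Sum>\<gamma>\<in>?A. Poly_Mapping.lookup (immaculate \<alpha>) \<gamma> * f \<gamma>) = (if \<alpha> = \<beta> then 1 else 0)"
    using unitriangular_system[of ?A lex_less "\<lambda>\<alpha>. Poly_Mapping.lookup (immaculate \<alpha>)" "\<lambda>\<alpha>. if \<alpha> = \<beta> then 1 else 0"]
      finite_csize_eq transp_lex_less lex_less_irrefl lookup_immaculate_self lookup_immaculate_nonzero
    by blast
  define F where "F = Series (\<lambda>m. if mdeg m = ?n then f (exps m) else 0)"
  have "quasi_symmetric F"
    unfolding quasi_symmetric_def F_def coeff_Series by (metis csize_exps)
  moreover have "mdeg m = ?n" if "coeff F m \<noteq> 0" for m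
    using that unfolding F_def coeff_Series by presburger
  ultimately have F: "F \<in> QSym_hom ?n"
    unfolding QSym_hom_def by blast
  have "M_coeff F \<gamma> = f \<gamma>" if "csize \<gamma> = ?n" for \<gamma>
    using that unfolding M_coeff_def F_def coeff_Series exps_nth mdeg_nth_parts by presburger
  then have "?P F"
    using F f by (simp add: pairing_QSym_hom[OF F])
  moreover have "G = F" if "?P G" for G
    using that \<open>?P F\<close> by (intro QSym_hom_eqI) auto
  ultimately show "\<exists>!F. ?P F" by blast
qed

theorem theorem3p23:
  fixes lam :: "nat list"
  assumes "sorted_wrt (\<ge>) lam" and "\<forall>x \<in> set lam. 0 < x"
  shows "schur lam =
    (\<Sum>\<sigma> | \<sigma> permutes {..<length lam} \<and>
        (\<forall>i < length lam. int (lam ! \<sigma> i) + int i - int (\<sigma> i) > 0).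
      of_int (sign \<sigma>) * dual_immaculate
        (Comp (map (\<lambda>i. nat (int (lam ! \<sigma> i) + int i - int (\<sigma> i))) [0..<length lam])))"
proof -
  define k where "k = length lam"
  define n where "n = sum_list lam"
  define e where "e \<sigma> i = int (lam ! \<sigma> i) + int i - int (\<sigma> i)" for \<sigma> :: "nat \<Rightarrow> nat" and i
  define S where "S = {\<sigma>. \<sigma> permutes {..<k} \<and> (\<forall>i<k. e \<sigma> i > 0)}"
  define c where "c \<sigma> = Comp (map (\<lambda>i. nat (e \<sigma> i)) [0..<k])" for \<sigma>
  define R where "R = (\<Sum>\<sigma>\<in>S. of_int (sign \<sigma>) * dual_immaculate (c \<sigma>))"
  have finite_S: "finite S"
    unfolding S_def by (rule finite_subset[OF _ finite_permutations[of "{..<k}"]]) auto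
  have parts_c: "parts (c \<sigma>) = map (\<lambda>i. nat (e \<sigma> i)) [0..<k]" if "\<sigma> \<in> S" for \<sigma>
    unfolding c_def using that by (intro parts_Comp) (auto simp: S_def)
  \<comment> \<open>The shifts i and -\<sigma>(i) cancel in the sum because \<sigma> is a
    permutation.\<close>
  have csize_c: "csize (c \<sigma>) = n" if \<sigma>: "\<sigma> \<in> S" for \<sigma>
  proof -
    have perm: "\<sigma> permutes {..<k}" using \<sigma> by (simp add: S_def)
    have "int (csize (c \<sigma>)) = (\<Sum>i<k. int (nat (e \<sigma> i)))"
      unfolding csize_def parts_c[OF \<sigma>] by (simp add: sum_list_sum_nth atLeast0LessThan)
    also have "\<dots> = (\<Sum>i<k. e \<sigma> i)"
      using \<sigma> by (intro sum.cong) (auto simp: S_def)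
    also have "\<dots> = (\<Sum>i<k. int (lam ! \<sigma> i)) + (\<Sum>i<k. int i) - (\<Sum>i<k. int (\<sigma> i))"
      by (simp add: e_def sum.distrib sum_subtractf)
    also have "\<dots> = (\<Sum>i<k. int (lam ! i))"
      using sum.permute[OF perm, of "\<lambda>i. int (lam ! i)"] sum.permute[OF perm, of int] by (simp add: o_def)
    also have "\<dots> = int n"
      by (simp add: n_def k_def sum_list_sum_nth atLeast0LessThan)
    finally show ?thesis by simp
  qed
  \<comment> \<open>For fixed \<alpha> this matches the permutations of the claimed sum with those
    of the Leibniz sum. From right to left, positivity of the entries comes from \<alpha> having
    positive parts.\<close>
  have c_eq_iff: "\<sigma> \<in> S \<and> c \<sigma> = \<alpha> \<longleftrightarrow>
      length (parts \<alpha>) = k \<and> \<sigma> permutes {..<k} \<and> (\<forall>i<k. int (parts \<alpha> ! i) = e \<sigma> i)" for \<sigma> \<alpha>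
  proof
    assume L: "\<sigma> \<in> S \<and> c \<sigma> = \<alpha>"
    then have "parts \<alpha> = map (\<lambda>i. nat (e \<sigma> i)) [0..<k]"
      using parts_c by blast
    with L show "length (parts \<alpha>) = k \<and> \<sigma> permutes {..<k} \<and> (\<forall>i<k. int (parts \<alpha> ! i) = e \<sigma> i)"
      by (auto simp: S_def less_imp_le)
  next
    assume R: "length (parts \<alpha>) = k \<and> \<sigma> permutes {..<k} \<and> (\<forall>i<k. int (parts \<alpha> ! i) = e \<sigma> i)"
    have "0 < parts \<alpha> ! i" if "i < k" for i
      using R that parts[of \<alpha>] nth_mem[of i "parts \<alpha>"] by auto
    then have "0 < e \<sigma> i" if "i < k" for i
      using R that by (metis of_nat_0_less_iff)
    then have "\<sigma> \<in> S"
      using R by (simp add: S_def)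
    moreover have "map (\<lambda>i. nat (e \<sigma> i)) [0..<k] = parts \<alpha>"
    proof (rule nth_equalityI)
      fix i assume "i < length (map (\<lambda>i. nat (e \<sigma> i)) [0..<k])"
      then have i: "i < k" by simp
      then have "e \<sigma> i = int (parts \<alpha> ! i)"
        using R by simp
      with i show "map (\<lambda>i. nat (e \<sigma> i)) [0..<k] ! i = parts \<alpha> ! i" by simp
    qed (use R in simp)
    then have "c \<sigma> = \<alpha>"
      unfolding c_def by (simp add: parts_inverse)
    ultimately show "\<sigma> \<in> S \<and> c \<sigma> = \<alpha>" by blast
  qed
  have "schur lam = R"
  proof (rule QSym_hom_eqI)
    show "schur lam \<in> QSym_hom n"
      unfolding n_def by (rule schur_in_QSym_hom[OF assms(1)])
    show "R \<in> QSym_hom n"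
      unfolding R_def
    proof (rule QSym_hom_sum)
      fix \<sigma> assume \<sigma>: "\<sigma> \<in> S"
      have "dual_immaculate (c \<sigma>) \<in> QSym_hom n"
        using dual_immaculate_spec[of "c \<sigma>"] unfolding csize_c[OF \<sigma>] ..
      then show "of_int (sign \<sigma>) * dual_immaculate (c \<sigma>) \<in> QSym_hom n"
        by (cases \<sigma> rule: sign_cases) (simp_all add: QSym_hom_uminus)
    qed
  next
    fix \<alpha> assume \<alpha>: "csize \<alpha> = n"
    have summand: "pairing (immaculate \<alpha>) (of_int (sign \<sigma>) * dual_immaculate (c \<sigma>)) =
        (if c \<sigma> = \<alpha> then of_int (sign \<sigma>) else 0)" if "\<sigma> \<in> S" for \<sigma>
    proof -
      have "pairing (immaculate \<alpha>) (dual_immaculate (c \<sigma>)) = (if \<alpha> = c \<sigma> then 1 else 0)"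
        using dual_immaculate_spec[of "c \<sigma>"] csize_c[OF that] \<alpha> by simp
      then show ?thesis
        using pairing_minus_one_power_right[of "immaculate \<alpha>" 1 "dual_immaculate (c \<sigma>)"]
        by (cases \<sigma> rule: sign_cases) simp_all
    qed
    have "pairing (immaculate \<alpha>) R = (\<Sum>\<sigma>\<in>S. if c \<sigma> = \<alpha> then of_int (sign \<sigma>) else 0)"
      unfolding R_def pairing_sum_right using summand by (intro sum.cong) simp_all
    also have "\<dots> = (\<Sum>\<sigma> | \<sigma> \<in> S \<and> c \<sigma> = \<alpha>. of_int (sign \<sigma>))"
      by (rule sum.inter_filter[OF finite_S, symmetric])
    \<comment> \<open>The diagonal index \<open>a i + i\<close> is here the part
      \<open>lam ! i\<close>, which is positive as the determinant formula requires.\<close>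
    also have "\<dots> = pairing (immaculate \<alpha>) (jt k (\<lambda>i. int (lam ! i) - int i))"
      unfolding c_eq_iff using assms(2)
      by (subst pairing_immaculate_jt) (auto simp: k_def e_def algebra_simps intro!: sum.cong)
    finally show "pairing (immaculate \<alpha>) (schur lam) = pairing (immaculate \<alpha>) R"
      by (simp add: jacobi_trudi[OF assms(1)] k_def)
  qed
  then show ?thesis
    unfolding R_def S_def c_def e_def k_def .
qed

end
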